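(* Let $\mathcal{R}$ be a left-linear TRS and $\phi,\psi:\mathcal{R}\to\mathbb{N}$ labeling functions such that $\mathcal{R}_{\phi,0}$ and $\mathcal{R}_{\psi,0}$ commute. Suppose that for all $(k,m)\in\mathbb{N}^2\setminus\{(0,0)\}$: every parallel critical peak between $\mathcal{R}_{\phi,k}$ and $\mathcal{R}_{\psi,m}$ is $(\psi,\phi)$-decreasing (with respect to $k,m$), and every parallel critical peak between $\mathcal{R}_{\psi,m}$ and $\mathcal{R}_{\phi,k}$ is $(\phi,\psi)$-decreasing (with respect to $m,k$). Then $\mathcal{R}$ is confluent.
   Context: A TRS is a set of rules $\ell\to r$ ($\ell\notin\mathcal{V}$, $\mathcal{V}ar(r)\subseteq\mathcal{V}ar(\ell)$); left-linear: no variable repeated in a left-hand side; TRSs $\mathcal{R},\mathcal{S}$ commute if ${}_\mathcal{R}\!\!\leftarrow^*\cdot\to_\mathcal{S}^*\subseteq\to_\mathcal{S}^*\cdot{}_\mathcal{R}\!\!\leftarrow^*$; confluence is self-commutation. Positions: $\epsilon$ root, parallel if neither is a prefix of the other, $\mathcal{P}os_\mathcal{F}(t)$ function-symbol positions. Parallel step: for a set $P$ of pairwise parallel positions of $s$, $s\overset{P}{\Rightarrow}_\mathcal{R}t$ iff for each $p\in P$ there are $\ell\to r\in\mathcal{R}$, $\mu$ with $s|_p=\ell\mu$, $t|_p=r\mu$, and $t=s[t|_p]_{p\in P}$; $\Rightarrow_\mathcal{R}$ if for some $P$; $\Leftarrow$ is the inverse. $\mathcal{V}ar(t,P)=\bigcup_{p\in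 P}\mathcal{V}ar(t|_p)$. Parallel critical peak between $\mathcal{R}$ and $\mathcal{S}$: for a variant $\ell\to r$ of an $\mathcal{S}$-rule, non-empty $P\subseteq\mathcal{P}os_\mathcal{F}(\ell)$ pairwise parallel, variants $\ell_p\to r_p$ ($p\in P$) of $\mathcal{R}$-rules, all pairwise variable-disjoint, $\sigma$ an mgu of $\{\ell_p\approx\ell|_p\}_{p\in P}$, and $\ell_\epsilon\to r_\epsilon$ not a variant of $\ell\to r$ if $P=\{\epsilon\}$: the peak $(\ell\sigma)[r_p\sigma]_{p\in P}\;{}_\mathcal{R}\!\overset{P}{\Leftarrow}\;\ell\sigma\xrightarrow{\epsilon}_\mathcal{S}r\sigma$. A labeling function for $\mathcal{R}$ is a function $\mathcal{R}\to\mathbb{N}$; $\mathcal{R}_{\phi,k}=\{\ell\to r\in\mathcal{R}\mid\phi(\ell\to r)\le k\}$, and $\to_{\phi,k}$, $\Rightarrow_{\phi,k}$ abbreviate $\to_{\mathcal{R}_{\phi,k}}$, $\Rightarrow_{\mathcal{R}_{\phi,k}}$. For labeling functions $\phi,\psi$ (used in either order), $\curlyvee k=\{j\in\mathbb{N}\mid j<k\}$, $\curlyvee km=\curlyvee k\cup\curlyvee m$, and for $K\subseteq\mathbb{N}$, $\leftrightarrow_K$ is the union of ${}_{\phi,j}\!\!\leftarrow$ and $\to_{\psi,j}$ for $j\in K$. A peak $t\;{}_{\phi,k}\!\overset{P}{\Leftarrow}\;s\xrightarrow{\epsilon}_{\psi,m}u$ is $(\psi,\phi)$-decreasing if there exist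 a term $v$ and a set $P'$ of pairwise parallel positions with $t\leftrightarrow^*_{\curlyvee k}\cdot\Rightarrow_{\psi,m}\cdot\leftrightarrow^*_{\curlyvee km} v$, $w\overset{P'}{\Rightarrow}_{\phi,k}v$ and $w\leftrightarrow^*_{\curlyvee m}u$ for some $w$, and $\mathcal{V}ar(v,P')\subseteq\mathcal{V}ar(s,P)$. The notion $(\phi,\psi)$-decreasing for a peak $t\;{}_{\psi,m}\!\overset{P}{\Leftarrow}\;s\xrightarrow{\epsilon}_{\phi,k}u$ is defined identically with the roles of $\phi,\psi$ and of $k,m$ exchanged (so $\leftrightarrow_K$ is then the union of ${}_{\psi,j}\!\!\leftarrow$ and $\to_{\phi,j}$). *)

theory Defs
  imports Main "HOL-Library.Sublist"
begin

section \<open>First-order terms, positions, substitutions\<close>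

datatype ('f, 'v) trm = Var 'v | Fun 'f "('f, 'v) trm list"

type_synonym pos = "nat list"
type_synonym ('f, 'v) rule = "('f, 'v) trm \<times> ('f, 'v) trm"
type_synonym ('f, 'v) subst = "'v \<Rightarrow> ('f, 'v) trm"

text \<open>Application of a substitution.\<close>
fun subst_apply :: "('f, 'v) trm \<Rightarrow> ('f, 'v) subst \<Rightarrow> ('f, 'v) trm" (infixl "\<cdot>" 67) where
  "Var x \<cdot> \<sigma> = \<sigma> x"
| "Fun f ts \<cdot> \<sigma> = Fun f (map (\<lambda>t. t \<cdot> \<sigma>) ts)"

text \<open>p is a position of t.\<close>
fun is_pos :: "('f, 'v) trm \<Rightarrow> pos \<Rightarrow> bool" where
  "is_pos t [] = True"
| "is_pos (Var x) (i # p) = False"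
| "is_pos (Fun f ts) (i # p) = (i < length ts \<and> is_pos (ts ! i) p)"

definition poss :: "('f, 'v) trm \<Rightarrow> pos set" where
  "poss t = {p. is_pos t p}"

text \<open>Subterm at a position t|_p.\<close>
fun subt_at :: "('f, 'v) trm \<Rightarrow> pos \<Rightarrow> ('f, 'v) trm" where
  "subt_at t [] = t"
| "subt_at (Var x) (i # p) = Var x"
| "subt_at (Fun f ts) (i # p) = subt_at (ts ! i) p"

text \<open>Replacement t[u]_p.\<close>
fun replace_at :: "('f, 'v) trm \<Rightarrow> pos \<Rightarrow> ('f, 'v) trm \<Rightarrow> ('f, 'v) trm" where
  "replace_at t [] u = u"
| "replace_at (Var x) (i # p) u = Var x"
| "replace_at (Fun f ts) (i # p) u = Fun f (ts[i := replace_at (ts ! i) p u])"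

definition is_Fun_trm :: "('f, 'v) trm \<Rightarrow> bool" where
  "is_Fun_trm t = (\<exists>f ts. t = Fun f ts)"

text \<open>Function-symbol positions Pos_F(t).\<close>
definition funposs :: "('f, 'v) trm \<Rightarrow> pos set" where
  "funposs t = {p. is_pos t p \<and> is_Fun_trm (subt_at t p)}"

definition vars :: "('f, 'v) trm \<Rightarrow> 'v set" where
  "vars t = {x. \<exists>p. is_pos t p \<and> subt_at t p = Var x}"

definition vars_rule :: "('f, 'v) rule \<Rightarrow> 'v set" where
  "vars_rule \<rho> = vars (fst \<rho>) \<union> vars (snd \<rho>)"

text \<open>Var(t,P) = union of Var(t|_p) for p in P.\<close>
definition vars_at :: "('f, 'v) trm \<Rightarrow> pos set \<Rightarrow> 'v set" where
  "vars_at t P = (\<Union>p\<in>P. vars (subt_at t p))"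

text \<open>Parallel positions.\<close>
definition par_pos :: "pos \<Rightarrow> pos \<Rightarrow> bool" where
  "par_pos p q \<longleftrightarrow> \<not> prefix p q \<and> \<not> prefix q p"

definition pairwise_par :: "pos set \<Rightarrow> bool" where
  "pairwise_par P \<longleftrightarrow> (\<forall>p\<in>P. \<forall>q\<in>P. p \<noteq> q \<longrightarrow> par_pos p q)"

text \<open>Simultaneous replacement s[f p]_{p \<in> P} at a finite set of pairwise parallel
  positions, performed as successive single replacements (the order is irrelevant
  for parallel positions).\<close>
definition par_replace :: "('f, 'v) trm \<Rightarrow> pos set \<Rightarrow> (pos \<Rightarrow> ('f, 'v) trm) \<Rightarrow> ('f, 'v) trm \<Rightarrow> bool" where
  "par_replace s P f t \<longleftrightarrow> (\<exists>ps. set ps = P \<and> t = foldr (\<lambda>p u. replace_at u p (f p)) ps s)"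

section \<open>Term rewriting\<close>

definition trs :: "('f, 'v) rule set \<Rightarrow> bool" where
  "trs R \<longleftrightarrow> (\<forall>(l, r)\<in>R. is_Fun_trm l \<and> vars r \<subseteq> vars l)"

definition linear_trm :: "('f, 'v) trm \<Rightarrow> bool" where
  "linear_trm t \<longleftrightarrow> (\<forall>p q x. is_pos t p \<and> is_pos t q \<and> subt_at t p = Var x \<and> subt_at t q = Var x \<longrightarrow> p = q)"

definition left_linear :: "('f, 'v) rule set \<Rightarrow> bool" where
  "left_linear R \<longleftrightarrow> (\<forall>(l, r)\<in>R. linear_trm l)"

text \<open>Rewrite step s \<rightarrow>_R t.\<close>
definition rstep :: "('f, 'v) rule set \<Rightarrow> (('f, 'v) trm \<times> ('f, 'v) trm) set" where
  "rstep R = {(s, t). \<exists>p l r \<sigma>. (l, r) \<in> R \<and> is_pos s p \<and> subt_at s p = l \<cdot> \<sigma>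
                 \<and> t = replace_at s p (r \<cdot> \<sigma>)}"

text \<open>Parallel step s \<Rightarrow>^P_R t.\<close>
definition par_step_at :: "('f, 'v) rule set \<Rightarrow> pos set \<Rightarrow> ('f, 'v) trm \<Rightarrow> ('f, 'v) trm \<Rightarrow> bool" where
  "par_step_at R P s t \<longleftrightarrow> P \<subseteq> poss s \<and> pairwise_par P
     \<and> (\<forall>p\<in>P. \<exists>l r \<mu>. (l, r) \<in> R \<and> subt_at s p = l \<cdot> \<mu> \<and> subt_at t p = r \<cdot> \<mu>)
     \<and> par_replace s P (subt_at t) t"

definition par_step :: "('f, 'v) rule set \<Rightarrow> (('f, 'v) trm \<times> ('f, 'v) trm) set" where
  "par_step R = {(s, t). \<exists>P. par_step_at R P s t}"

definition commute :: "('f, 'v) rule set \<Rightarrow> ('f, 'v) rule set \<Rightarrow> bool" where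
  "commute R S \<longleftrightarrow> ((rstep R)\<inverse>)\<^sup>* O (rstep S)\<^sup>* \<subseteq> (rstep S)\<^sup>* O ((rstep R)\<inverse>)\<^sup>*"

definition confluent :: "('f, 'v) rule set \<Rightarrow> bool" where
  "confluent R \<longleftrightarrow> commute R R"

section \<open>Unification, variants, parallel critical peaks\<close>

definition unifier :: "('f, 'v) subst \<Rightarrow> (('f, 'v) trm \<times> ('f, 'v) trm) set \<Rightarrow> bool" where
  "unifier \<sigma> E \<longleftrightarrow> (\<forall>(a, b)\<in>E. a \<cdot> \<sigma> = b \<cdot> \<sigma>)"

definition mgu :: "('f, 'v) subst \<Rightarrow> (('f, 'v) trm \<times> ('f, 'v) trm) set \<Rightarrow> bool" where
  "mgu \<sigma> E \<longleftrightarrow> unifier \<sigma> E \<and> (\<forall>\<tau>. unifier \<tau> E \<longrightarrow> (\<exists>\<gamma>. \<forall>x. \<tau> x = \<sigma> x \<cdot> \<gamma>))"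

text \<open>\<rho>' is a variant of \<rho>: obtained by a bijective renaming of variables.\<close>
definition variant :: "('f, 'v) rule \<Rightarrow> ('f, 'v) rule \<Rightarrow> bool" where
  "variant \<rho>' \<rho> \<longleftrightarrow> (\<exists>\<pi>. bij \<pi> \<and> fst \<rho>' = fst \<rho> \<cdot> (Var \<circ> \<pi>) \<and> snd \<rho>' = snd \<rho> \<cdot> (Var \<circ> \<pi>))"

text \<open>Parallel critical peak t \<Leftarrow>^P_R s \<rightarrow>^\<epsilon>_S u between R and S
  (R-rules at the parallel positions P, S-rule at the root).\<close>
definition par_crit_peak ::
  "('f, 'v) rule set \<Rightarrow> ('f, 'v) rule set \<Rightarrow> ('f, 'v) trm \<Rightarrow> pos set \<Rightarrow> ('f, 'v) trm \<Rightarrow> ('f, 'v) trm \<Rightarrow> bool" where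
  "par_crit_peak R S t P s u \<longleftrightarrow>
    (\<exists>l r lr \<sigma>.
       (\<exists>\<rho>\<in>S. variant (l, r) \<rho>)
     \<and> P \<noteq> {} \<and> P \<subseteq> funposs l \<and> pairwise_par P
     \<and> (\<forall>p\<in>P. \<exists>\<rho>\<in>R. variant (lr p) \<rho>)
     \<and> (\<forall>p\<in>P. vars_rule (lr p) \<inter> vars_rule (l, r) = {})
     \<and> (\<forall>p\<in>P. \<forall>q\<in>P. p \<noteq> q \<longrightarrow> vars_rule (lr p) \<inter> vars_rule (lr q) = {})
     \<and> mgu \<sigma> {(fst (lr p), subt_at l p) | p. p \<in> P}
     \<and> (P = {[]} \<longrightarrow> \<not> variant (lr []) (l, r))
     \<and> s = l \<cdot> \<sigma> \<and> u = r \<cdot> \<sigma>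
     \<and> par_replace s P (\<lambda>p. snd (lr p) \<cdot> \<sigma>) t)"

section \<open>Labelings and decreasingness\<close>

definition lab :: "('f, 'v) rule set \<Rightarrow> (('f, 'v) rule \<Rightarrow> nat) \<Rightarrow> nat \<Rightarrow> ('f, 'v) rule set" where
  "lab R \<phi> k = {\<rho> \<in> R. \<phi> \<rho> \<le> k}"

text \<open>\<leftrightarrow>_K for the labeling pair (\<phi>,\<psi>): union of _{\<phi>,j}\<leftarrow> and \<rightarrow>_{\<psi>,j} for j \<in> K.\<close>
definition conv_lab :: "('f, 'v) rule set \<Rightarrow> (('f, 'v) rule \<Rightarrow> nat) \<Rightarrow> (('f, 'v) rule \<Rightarrow> nat)
    \<Rightarrow> nat set \<Rightarrow> (('f, 'v) trm \<times> ('f, 'v) trm) set" where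
  "conv_lab R \<phi> \<psi> K = (\<Union>j\<in>K. (rstep (lab R \<phi> j))\<inverse> \<union> rstep (lab R \<psi> j))"

text \<open>decreasing R \<phi> \<psi> k m t P s u: the peak t \<Leftarrow>^P_{\<phi>,k} s \<rightarrow>^\<epsilon>_{\<psi>,m} u is
  (\<psi>,\<phi>)-decreasing in the sense of the paper.\<close>
definition decreasing :: "('f, 'v) rule set \<Rightarrow> (('f, 'v) rule \<Rightarrow> nat) \<Rightarrow> (('f, 'v) rule \<Rightarrow> nat)
    \<Rightarrow> nat \<Rightarrow> nat \<Rightarrow> ('f, 'v) trm \<Rightarrow> pos set \<Rightarrow> ('f, 'v) trm \<Rightarrow> ('f, 'v) trm \<Rightarrow> bool" where
  "decreasing R \<phi> \<psi> k m t P s u \<longleftrightarrow>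
    (\<exists>v P'.
       (t, v) \<in> (conv_lab R \<phi> \<psi> {j. j < k})\<^sup>* O par_step (lab R \<psi> m)
                 O (conv_lab R \<phi> \<psi> ({j. j < k} \<union> {j. j < m}))\<^sup>*
     \<and> (\<exists>w. par_step_at (lab R \<phi> k) P' w v \<and> (w, u) \<in> (conv_lab R \<phi> \<psi> {j. j < m})\<^sup>*)
     \<and> vars_at v P' \<subseteq> vars_at s P)"

end

theory Submission
  imports Defs
begin

text \<open>
  Parallel steps with labels at most \<open>k\<close> are compared for \<open>\<phi>\<close> (relations \<open>A k\<close>) and \<open>\<psi>\<close>
  (relations \<open>B m\<close>). Left-linearity splits a parallel step from an instance of a left-hand side into
  overlapping redexes and a step inside the substitution. The former give an instance of a parallel
  critical peak; the latter survives in its decreasing diagram because of the variable condition.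
  Hence every parallel peak \<open>(k, m) \<noteq> (0, 0)\<close> has a decreasing diagram.

  Since the relations grow with the label, decreasing diagrams need no multiset measure here: if
  \<open>A i\<close> and \<open>B i\<close> commute for all \<open>i < n\<close>, conversions with labels below \<open>n\<close> are valleys, and
  modulo such conversions a step of \<open>A n\<close> and a step of \<open>B n\<close> have the diamond property.
  The given commutation of \<open>A 0\<close> and \<open>B 0\<close> starts this induction, and every finite rewrite
  sequence uses finitely many rules, so it lies in some \<open>A n\<close> and in some \<open>B n\<close>.
\<close>

section \<open>Abstract commutation: two families of relations that grow with their label\<close>

section \<open>Decreasing diagrams for increasing families\<close>

text \<open>\<open>A\<close> is traversed backwards and \<open>B\<close> forwards, so peaks and
  valleys of an \<open>A\<close> sequence against a \<open>B\<close> sequence are themselves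
  conversions, and taking the converse exchanges the families.\<close>

definition conv_below :: "(nat \<Rightarrow> 'a rel) \<Rightarrow> (nat \<Rightarrow> 'a rel) \<Rightarrow> nat \<Rightarrow> 'a rel" where
  "conv_below A B k = (\<Union>j<k. (A j)\<inverse> \<union> B j)\<^sup>*"

lemma conv_below_refl [simp]: "(x, x) \<in> conv_below A B k"
  by (simp add: conv_below_def)

lemma conv_below_trans: "(x, y) \<in> conv_below A B k \<Longrightarrow> (y, z) \<in> conv_below A B k \<Longrightarrow> (x, z) \<in> conv_below A B k"
  by (simp add: conv_below_def)

lemma conv_below_zero [simp]: "conv_below A B 0 = Id"
  by (simp add: conv_below_def)

lemma converse_conv_below: "(conv_below A B k)\<inverse> = conv_below B A k"
proof -
  have "(\<Union>j<k. (A j)\<inverse> \<union> B j)\<inverse> = (\<Union>j<k. (B j)\<inverse> \<union> A j)" by auto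
  then show ?thesis by (simp add: conv_below_def rtrancl_converse[symmetric])
qed

lemma conv_below_sym: "(x, y) \<in> conv_below A B k \<longleftrightarrow> (y, x) \<in> conv_below B A k"
  using converse_conv_below[of A B k] by auto

lemma forward_conv_below: "j < k \<Longrightarrow> (x, y) \<in> (B j)\<^sup>* \<Longrightarrow> (x, y) \<in> conv_below A B k"
  unfolding conv_below_def by (rule rtrancl_mono[THEN subsetD, of "B j"]) auto

lemma backward_conv_below: "j < k \<Longrightarrow> (y, x) \<in> (A j)\<^sup>* \<Longrightarrow> (x, y) \<in> conv_below A B k"
  using forward_conv_below[of j k y x A B] by (simp add: conv_below_sym)

text \<open>The Church-Rosser form of commutation. For increasing families it is equivalent to
  commutation of \<open>A n\<close> and \<open>B n\<close>, but it applies to mixed conversions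
  directly.\<close>

definition cr_at :: "(nat \<Rightarrow> 'a rel) \<Rightarrow> (nat \<Rightarrow> 'a rel) \<Rightarrow> nat \<Rightarrow> bool" where
  "cr_at A B n \<longleftrightarrow> (\<forall>x y. (x, y) \<in> conv_below A B (Suc n) \<longrightarrow> (\<exists>z. (x, z) \<in> (B n)\<^sup>* \<and> (y, z) \<in> (A n)\<^sup>*))"

lemma cr_at_swap: "cr_at A B n \<Longrightarrow> cr_at B A n"
  unfolding cr_at_def using conv_below_sym[of _ _ A B] by blast

text \<open>An \<open>A k\<close> step is pushed along a whole \<open>B j\<close> sequence and stays
  a single step; the price is a conversion below \<open>k\<close> at its target and one below
  \<open>j\<close> at its source.\<close>

definition absorbs :: "(nat \<Rightarrow> 'a rel) \<Rightarrow> (nat \<Rightarrow> 'a rel) \<Rightarrow> nat \<Rightarrow> nat \<Rightarrow> bool" where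
  "absorbs A B k j \<longleftrightarrow> (\<forall>s t u. (s, t) \<in> A k \<longrightarrow> (s, u) \<in> (B j)\<^sup>* \<longrightarrow>
     (\<exists>v w. (t, v) \<in> conv_below A B k \<and> (w, v) \<in> A k \<and> (w, u) \<in> conv_below A B j))"

locale decreasing_family =
  fixes A B :: "nat \<Rightarrow> 'a rel"
  assumes mono_A: "i \<le> j \<Longrightarrow> A i \<subseteq> A j"
    and mono_B: "i \<le> j \<Longrightarrow> B i \<subseteq> B j"
    and base: "(s, t) \<in> (A 0)\<^sup>* \<Longrightarrow> (s, u) \<in> (B 0)\<^sup>* \<Longrightarrow> \<exists>v. (t, v) \<in> (B 0)\<^sup>* \<and> (u, v) \<in> (A 0)\<^sup>*"
    and peak: "(k, m) \<noteq> (0, 0) \<Longrightarrow> (A k)\<inverse> O B m \<subseteq>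
      conv_below A B k O B m O conv_below A B (max k m) O (A k)\<inverse> O conv_below A B m"
begin

lemmas cb_refl = conv_below_refl[of _ A B]
lemmas cb_trans = conv_below_trans[of _ _ A B]

text \<open>Taking the converse of \<open>peak\<close> exchanges the families, which makes every
  later result available in both orientations.\<close>

lemma swap: "decreasing_family B A"
proof
  fix k m :: nat
  assume "(k, m) \<noteq> (0, 0)"
  then have "((A m)\<inverse> O B k)\<inverse> \<subseteq> (conv_below A B m O B k O conv_below A B (max m k) O (A m)\<inverse> O conv_below A B k)\<inverse>"
    using peak[of m k] by auto
  then show "(B k)\<inverse> O A m \<subseteq>
      conv_below B A k O A m O conv_below B A (max k m) O (B k)\<inverse> O conv_below B A m"
    by (simp add: converse_relcomp converse_conv_below O_assoc max.commute)
next
  fix s t u assume "(s, t) \<in> (B 0)\<^sup>*" "(s, u) \<in> (A 0)\<^sup>*"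
  then show "\<exists>v. (t, v) \<in> (A 0)\<^sup>* \<and> (u, v) \<in> (B 0)\<^sup>*" using base by blast
qed (use mono_A mono_B in auto)

lemma conv_below_Suc: "conv_below A B (Suc n) = ((A n)\<inverse> \<union> B n)\<^sup>*"
proof -
  have "(\<Union>j<Suc n. (A j)\<inverse> \<union> B j) = (A n)\<inverse> \<union> B n"
    using mono_A[of _ n] mono_B[of _ n] by (fastforce simp: less_Suc_eq_le)
  then show ?thesis by (simp add: conv_below_def)
qed

text \<open>The conversion left over by \<open>absorbs\<close> is a valley with a label one lower,
  so the step can be pushed along the \<open>B\<close> half of that valley again. At label 0 the
  leftover is an equality, and only \<open>A\<close> steps remain.\<close>

lemma absorbs_valley:
  assumes "\<And>i. i \<le> j \<Longrightarrow> absorbs A B k i" and "\<And>i. i < j \<Longrightarrow> cr_at A B i"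
    and "(s, t) \<in> A k" "(s, u) \<in> (B j)\<^sup>*"
  shows "\<exists>v w. (t, v) \<in> conv_below A B k \<and> (w, v) \<in> A k \<and> (u, w) \<in> (A j)\<^sup>*"
  using assms
proof (induction j arbitrary: s t u)
  case 0
  then show ?case unfolding absorbs_def by (metis pair_in_Id_conv conv_below_zero le0 rtrancl.rtrancl_refl)
next
  case (Suc j)
  obtain v w where vw: "(t, v) \<in> conv_below A B k" "(w, v) \<in> A k" "(w, u) \<in> conv_below A B (Suc j)"
    using Suc.prems(1)[OF le_refl] Suc.prems(3,4) unfolding absorbs_def by blast
  obtain z where z: "(w, z) \<in> (B j)\<^sup>*" "(u, z) \<in> (A j)\<^sup>*"
    using Suc.prems(2)[of j] vw(3) unfolding cr_at_def by blast
  obtain v' w' where v': "(v, v') \<in> conv_below A B k" "(w', v') \<in> A k" "(z, w') \<in> (A j)\<^sup>*"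
    using Suc.IH[OF _ _ vw(2) z(1)] Suc.prems(1,2) by auto
  have "(u, w') \<in> (A (Suc j))\<^sup>*"
    using z(2) v'(3) rtrancl_mono[OF mono_A[of j "Suc j"]] by (meson le_SucI le_refl rtrancl_trans subsetD)
  then show ?case using v' vw cb_trans by blast
qed

text \<open>Passing the left step through the forward half of the valley and the right step through the
  backward half lowers the bound on the labels in between by one.\<close>

lemma squeeze:
  assumes "\<And>i. i < j \<Longrightarrow> absorbs A B k i" and "\<And>i. i < j \<Longrightarrow> absorbs B A m i"
    and "\<And>i. i < j \<Longrightarrow> cr_at A B i"
    and "i \<le> j" "(y, x) \<in> A k" "(y, z) \<in> conv_below A B i" "(z, w) \<in> B m"
  shows "\<exists>p q r. (x, p) \<in> conv_below A B k \<and> (q, p) \<in> A k \<and> (q, r) \<in> B m \<and> (r, w) \<in> conv_below A B m"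
  using assms(4-)
proof (induction i arbitrary: x y z w)
  case 0
  then have "y = z" by simp
  then show ?case using 0 cb_refl by blast
next
  case (Suc i)
  have i: "i < j" using Suc.prems by simp
  obtain z' where z': "(y, z') \<in> (B i)\<^sup>*" "(z, z') \<in> (A i)\<^sup>*"
    using assms(3)[OF i] Suc.prems unfolding cr_at_def by blast
  obtain v y' where v: "(x, v) \<in> conv_below A B k" "(y', v) \<in> A k" "(z', y') \<in> (A i)\<^sup>*"
    using absorbs_valley[OF _ _ Suc.prems(2) z'(1)] assms(1,3) i by force
  \<comment> \<open>Both \<open>A\<close> sequences run in the same direction, so the
    \<open>B m\<close> step can be pushed along their concatenation; the gap to \<open>y'\<close> is
    then a conversion below \<open>i\<close>.\<close>
  have "(z, y') \<in> (A i)\<^sup>*" using z'(2) v(3) by simp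
  then obtain v' w' where w: "(w, v') \<in> conv_below B A m" "(w', v') \<in> B m" "(w', y') \<in> conv_below B A i"
    using assms(2)[OF i] Suc.prems(4) unfolding absorbs_def by blast
  obtain p q r where "(v, p) \<in> conv_below A B k" "(q, p) \<in> A k" "(q, r) \<in> B m" "(r, v') \<in> conv_below A B m"
    using Suc.IH[OF _ v(2) _ w(2)] w(3) i by (auto simp: conv_below_sym[of _ _ B A])
  then show ?case using v w conv_below_trans[of x v A B k p] conv_below_trans[of r v' A B m w]
    by (auto simp: conv_below_sym[of _ _ B A])
qed

text \<open>The \<open>B j\<close> steps are treated one at a time: \<open>squeeze\<close> removes
  the conversion in front of the step, and \<open>peak\<close> closes the resulting local peak.
  Since \<open>j < k\<close>, the \<open>B j\<close> step of that diagram belongs to a conversion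
  below \<open>k\<close>, so only the \<open>A k\<close> step is left over.\<close>

lemma absorbs_step:
  assumes "\<And>i. i < j \<Longrightarrow> absorbs A B k i" and "\<And>i. i < j \<Longrightarrow> absorbs B A j i"
    and "\<And>i. i < j \<Longrightarrow> cr_at A B i"
    and "j < k"
  shows "absorbs A B k j"
  unfolding absorbs_def
proof (intro allI impI)
  fix s t u
  assume "(s, t) \<in> A k"
  assume "(s, u) \<in> (B j)\<^sup>*"
  then show "\<exists>v w. (t, v) \<in> conv_below A B k \<and> (w, v) \<in> A k \<and> (w, u) \<in> conv_below A B j"
  proof (induction rule: rtrancl_induct)
    case base
    then show ?case using \<open>(s, t) \<in> A k\<close> cb_refl by blast
  next
    case (step y z)
    then obtain v w where 1: "(t, v) \<in> conv_below A B k" "(w, v) \<in> A k" "(w, y) \<in> conv_below A B j" by blast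
    obtain p q r where 2: "(v, p) \<in> conv_below A B k" "(q, p) \<in> A k" "(q, r) \<in> B j" "(r, z) \<in> conv_below A B j"
      using squeeze[OF assms(1-3) le_refl 1(2,3) step(2)] by blast
    have "(p, r) \<in> (A k)\<inverse> O B j" using 2 by blast
    moreover have "(k, j) \<noteq> (0, 0)" "max k j = k" using assms(4) by auto
    ultimately obtain a b c d where 3: "(p, a) \<in> conv_below A B k" "(a, b) \<in> B j" "(b, c) \<in> conv_below A B k"
       "(d, c) \<in> A k" "(d, r) \<in> conv_below A B j"
      using peak[of k j] by (auto dest!: subsetD)
    have "(t, c) \<in> conv_below A B k"
      using 1(1) 2(1) 3(1,3) forward_conv_below[OF assms(4), of a b B] 3(2)
      by (meson cb_trans r_into_rtrancl)
    then show ?case using 3 2 conv_below_trans[of d r A B j z] by blast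
  qed
qed

end

text \<open>Both orientations go through one induction on \<open>j\<close> with \<open>k\<close>
  arbitrary, because pushing along \<open>B j\<close> requires that a \<open>B j\<close> step can
  itself be pushed along each \<open>A i\<close> with \<open>i < j\<close>.\<close>

lemma absorbs_below:
  assumes "decreasing_family A B"
    and cr: "\<And>i. i < n \<Longrightarrow> cr_at A B i" and "j < k" "k \<le> n"
  shows "absorbs A B k j \<and> absorbs B A k j"
  using assms(3-)
proof (induction j arbitrary: k rule: less_induct)
  case (less j)
  interpret AB: decreasing_family A B by fact
  interpret BA: decreasing_family B A by (rule AB.swap)
  show ?case
    using less AB.absorbs_step[of j k] BA.absorbs_step[of j k] cr cr_at_swap[OF cr] by auto
qed

section \<open>Induction over the labels\<close>

context decreasing_family
begin

text \<open>Tiling the diamond modulo conversions below \<open>n\<close> commutes the closures;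
  afterwards the interspersed conversions are moved to the middle and replaced by a valley.\<close>

lemma cr_at_step:
  assumes cr: "\<And>i. i < n \<Longrightarrow> cr_at A B i" and "n > 0"
  shows "cr_at A B n"
proof -
  let ?C = "conv_below A B n"
  have abs: "absorbs A B n j" "absorbs B A n j" if "j < n" for j
    using absorbs_below[of A B n j n] that cr decreasing_family_axioms by auto
  obtain n' where n': "n = Suc n'" using \<open>n > 0\<close> by (cases n) auto
  have C_decomp: "\<exists>z. (x, z) \<in> (B n)\<^sup>* \<and> (y, z) \<in> (A n)\<^sup>*" if "(x, y) \<in> ?C" for x y
    using cr[of n'] that rtrancl_mono[OF mono_A[of n' n]] rtrancl_mono[OF mono_B[of n' n]]
    unfolding n' cr_at_def by (meson le_SucI le_refl lessI subsetD)
  \<comment> \<open>Single steps with label \<open>n\<close> modulo smaller conversions,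
    \<open>X\<close> directed backwards and \<open>Y\<close> forwards.\<close>
  define X where "X = ?C O (A n)\<inverse> O ?C"
  define Y where "Y = ?C O B n O ?C"
  have XY: "X O Y \<subseteq> Y O X"
  proof (rule subrelI)
    fix x y assume "(x, y) \<in> X O Y"
    then obtain a b z c d where "(x, a) \<in> ?C" "(b, a) \<in> A n" "(b, z) \<in> ?C" "(z, c) \<in> ?C" "(c, d) \<in> B n" "(d, y) \<in> ?C"
      unfolding X_def Y_def by blast
    then have 1: "(x, a) \<in> ?C" "(b, a) \<in> A n" "(b, c) \<in> ?C" "(c, d) \<in> B n" "(d, y) \<in> ?C"
      using cb_trans by blast+
    \<comment> \<open>Removing the conversion between the two steps leaves a genuine local peak at
      \<open>q\<close>.\<close>
    obtain p q r where 2: "(a, p) \<in> ?C" "(q, p) \<in> A n" "(q, r) \<in> B n" "(r, d) \<in> ?C"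
      using squeeze[OF abs(1) abs(2) cr le_refl 1(2,3,4)] by blast
    have "(p, r) \<in> (A n)\<inverse> O B n" using 2 by blast
    then obtain a' b' c' d' where 3: "(p, a') \<in> ?C" "(a', b') \<in> B n" "(b', c') \<in> ?C" "(d', c') \<in> A n" "(d', r) \<in> ?C"
      using peak[of n n] \<open>n > 0\<close> by (auto dest!: subsetD)
    have "(x, a') \<in> ?C" "(d', y) \<in> ?C" using 1 2 3 cb_trans by meson+
    then have "(x, b') \<in> Y" "(b', y) \<in> X" unfolding X_def Y_def using 3 cb_refl by blast+
    then show "(x, y) \<in> Y O X" by blast
  qed
  have step: "X O Y\<^sup>* \<subseteq> Y\<^sup>* O X"
  proof (rule subrelI)
    fix x z assume "(x, z) \<in> X O Y\<^sup>*"
    then obtain y where y: "(x, y) \<in> X" "(y, z) \<in> Y\<^sup>*" by blast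
    from y(2) show "(x, z) \<in> Y\<^sup>* O X"
    proof (induction rule: rtrancl_induct)
      case (step a b)
      then show ?case using XY by (meson relcomp.cases relcomp.relcompI rtrancl.rtrancl_into_rtrancl subset_eq Pair_inject)
    qed (use y in blast)
  qed
  have XYs: "(x, z) \<in> Y\<^sup>* O X\<^sup>*" if "(x, z) \<in> (X \<union> Y)\<^sup>*" for x z
    using that
  proof (induction rule: converse_rtrancl_induct)
    case (step a b)
    then obtain c where c: "(b, c) \<in> Y\<^sup>*" "(c, z) \<in> X\<^sup>*" by blast
    show ?case
    proof (cases "(a, b) \<in> Y")
      case True
      then show ?thesis using c by (meson converse_rtrancl_into_rtrancl relcomp.relcompI)
    next
      case False
      then have "(a, c) \<in> Y\<^sup>* O X" using step \<open>(b, c) \<in> Y\<^sup>*\<close> assms subsetD[OF \<open>X O Y\<^sup>* \<subseteq> Y\<^sup>* O X\<close>, of "(a, c)"] by blast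
      then show ?thesis using c by (meson converse_rtrancl_into_rtrancl relcomp.cases relcomp.relcompI Pair_inject)
    qed
  qed blast
  \<comment> \<open>A conversion in front of a \<open>B n\<close> step moves behind it at the cost
    of further \<open>B\<close> steps: its valley supplies an \<open>A n'\<close> sequence along
    which the \<open>B n\<close> step is pushed.\<close>
  have cB: "\<exists>p. (x, p) \<in> (B n)\<^sup>* \<and> (p, w) \<in> ?C" if xzw: "(x, z) \<in> ?C" "(z, w) \<in> B n" for x z w
  proof -
    interpret BA: decreasing_family B A by (rule swap)
    have less: "n' < n" using n' by simp
    obtain y where y: "(x, y) \<in> (B n')\<^sup>*" "(z, y) \<in> (A n')\<^sup>*"
      using cr[OF less] xzw(1) unfolding n' cr_at_def by blast
    obtain v u where vu: "(w, v) \<in> conv_below B A n" "(u, v) \<in> B n" "(y, u) \<in> (B n')\<^sup>*"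
      using BA.absorbs_valley[OF _ _ xzw(2) y(2)] abs(2) cr cr_at_swap less by (metis less_trans order_le_less_trans)
    have "(x, u) \<in> (B n')\<^sup>*" using y vu by simp
    then have "(x, u) \<in> (B n)\<^sup>*" using rtrancl_mono[OF mono_B[of n' n]] less by auto
    then show ?thesis using vu by (meson conv_below_sym rtrancl.rtrancl_into_rtrancl)
  qed
  have cA: "\<exists>p. (x, p) \<in> (A n)\<^sup>* \<and> (w, p) \<in> ?C" if xzw: "(z, x) \<in> ?C" "(z, w) \<in> A n" for x z w
  proof -
    have less: "n' < n" using n' by simp
    obtain y where y: "(z, y) \<in> (B n')\<^sup>*" "(x, y) \<in> (A n')\<^sup>*"
      using cr[OF less] xzw(1) unfolding n' cr_at_def by blast
    obtain v u where vu: "(w, v) \<in> conv_below A B n" "(u, v) \<in> A n" "(y, u) \<in> (A n')\<^sup>*"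
      using absorbs_valley[OF _ _ xzw(2) y(1)] abs(1) cr less by (metis less_trans order_le_less_trans)
    have "(x, u) \<in> (A n')\<^sup>*" using y vu by simp
    then have "(x, u) \<in> (A n)\<^sup>*" using rtrancl_mono[OF mono_A[of n' n]] less by auto
    then show ?thesis using vu by (meson rtrancl.rtrancl_into_rtrancl)
  qed
  have Ys: "\<exists>p. (x, p) \<in> (B n)\<^sup>* \<and> (p, y) \<in> ?C" if "(x, y) \<in> Y\<^sup>*" for x y
    using that
  proof (induction rule: rtrancl_induct)
    case base
    then show ?case using cb_refl by blast
  next
    case (step y z)
    then obtain p a b where p: "(x, p) \<in> (B n)\<^sup>*" "(p, y) \<in> ?C" "(y, a) \<in> ?C" "(a, b) \<in> B n" "(b, z) \<in> ?C"
      unfolding Y_def by blast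
    then obtain q where "(p, q) \<in> (B n)\<^sup>*" "(q, b) \<in> ?C" using cB[of p a b] cb_trans by metis
    then show ?case using p by (meson cb_trans rtrancl_trans)
  qed
  have Xs: "\<exists>p. (y, p) \<in> (A n)\<^sup>* \<and> (x, p) \<in> ?C" if "(x, y) \<in> X\<^sup>*" for x y
    using that
  proof (induction rule: converse_rtrancl_induct)
    case base
    then show ?case using cb_refl by blast
  next
    case (step x z)
    then obtain p a b where p: "(y, p) \<in> (A n)\<^sup>*" "(z, p) \<in> ?C" "(x, a) \<in> ?C" "(b, a) \<in> A n" "(b, z) \<in> ?C"
      unfolding X_def by blast
    then obtain q where "(p, q) \<in> (A n)\<^sup>*" "(a, q) \<in> ?C" using cA[of b p a] cb_trans by metis
    then show ?case using p by (meson cb_trans rtrancl_trans)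
  qed
  show ?thesis unfolding cr_at_def
  proof (intro allI impI)
    fix x y assume "(x, y) \<in> conv_below A B (Suc n)"
    moreover have "(a, b) \<in> X" if "(a, b) \<in> (A n)\<inverse>" for a b
      unfolding X_def by (rule relcompI[OF cb_refl relcompI[OF that cb_refl]])
    moreover have "(a, b) \<in> Y" if "(a, b) \<in> B n" for a b
      unfolding Y_def by (rule relcompI[OF cb_refl relcompI[OF that cb_refl]])
    then have "(A n)\<inverse> \<union> B n \<subseteq> X \<union> Y" using calculation(2) by auto
    ultimately have "(x, y) \<in> (X \<union> Y)\<^sup>*" unfolding conv_below_Suc using rtrancl_mono by (meson subsetD)
    then obtain z where "(x, z) \<in> Y\<^sup>*" "(z, y) \<in> X\<^sup>*" using XYs by blast
    \<comment> \<open>What remains between \<open>p\<close> and \<open>q\<close> is a conversion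
      below \<open>n\<close>, hence a valley.\<close>
    then obtain p q where "(x, p) \<in> (B n)\<^sup>*" "(p, z) \<in> ?C" "(y, q) \<in> (A n)\<^sup>*" "(z, q) \<in> ?C"
      using Ys Xs by metis
    then show "\<exists>z. (x, z) \<in> (B n)\<^sup>* \<and> (y, z) \<in> (A n)\<^sup>*" using C_decomp[of p q]
      by (meson cb_trans rtrancl_trans)
  qed
qed

text \<open>The pair \<open>(0, 0)\<close> is excluded from \<open>peak\<close>, so the induction
  starts from \<open>base\<close>, applied once for every forward step of the conversion.\<close>

lemma cr_at_zero: "cr_at A B 0"
  unfolding cr_at_def conv_below_Suc
proof (intro allI impI)
  fix x y assume "(x, y) \<in> ((A 0)\<inverse> \<union> B 0)\<^sup>*"
  then show "\<exists>z. (x, z) \<in> (B 0)\<^sup>* \<and> (y, z) \<in> (A 0)\<^sup>*"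
  proof (induction rule: rtrancl_induct)
    case (step y z)
    then obtain w where w: "(x, w) \<in> (B 0)\<^sup>*" "(y, w) \<in> (A 0)\<^sup>*" by blast
    show ?case
    proof (cases "(y, z) \<in> B 0")
      case True
      then show ?thesis using base[OF w(2) r_into_rtrancl] w(1) by (meson rtrancl_trans)
    next
      case False
      then show ?thesis using step w by (meson UnE converse_iff converse_rtrancl_into_rtrancl)
    qed
  qed blast
qed

theorem cr_at: "cr_at A B n"
proof (induction n rule: less_induct)
  case (less n)
  then show ?case using cr_at_zero cr_at_step[of n] by (cases "n = 0") auto
qed

end

section \<open>Variables, substitutions and linearity\<close>

section \<open>Terms\<close>

lemma is_pos_Var [simp]: "is_pos (Var x) p \<longleftrightarrow> p = []"
  by (cases p) auto

lemma vars_Var [simp]: "vars (Var x) = {x}"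
  by (simp add: vars_def)

lemma vars_Fun [simp]: "vars (Fun f ts) = (\<Union>t\<in>set ts. vars t)"
proof (intro set_eqI iffI)
  fix x assume "x \<in> vars (Fun f ts)"
  then obtain p where "is_pos (Fun f ts) p" "subt_at (Fun f ts) p = Var x" by (auto simp: vars_def)
  then show "x \<in> (\<Union>t\<in>set ts. vars t)" by (cases p) (auto simp: vars_def)
next
  fix x assume "x \<in> (\<Union>t\<in>set ts. vars t)"
  then obtain i p where "i < length ts" "is_pos (ts ! i) p" "subt_at (ts ! i) p = Var x"
    by (auto simp: vars_def in_set_conv_nth)
  then have "is_pos (Fun f ts) (i # p) \<and> subt_at (Fun f ts) (i # p) = Var x" by simp
  then show "x \<in> vars (Fun f ts)" unfolding vars_def by blast
qed

lemma finite_vars [simp]: "finite (vars t)"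
  by (induction t) auto

lemma subst_cong: "(\<And>x. x \<in> vars t \<Longrightarrow> \<sigma> x = \<tau> x) \<Longrightarrow> t \<cdot> \<sigma> = t \<cdot> \<tau>"
  by (induction t) auto

lemma subst_eqD: "t \<cdot> \<sigma> = t \<cdot> \<tau> \<Longrightarrow> x \<in> vars t \<Longrightarrow> \<sigma> x = \<tau> x"
  by (induction t) auto

lemma subst_Var [simp]: "t \<cdot> Var = t"
  by (induction t) (auto simp: map_idI)

lemma subst_subst: "t \<cdot> \<sigma> \<cdot> \<tau> = t \<cdot> (\<lambda>x. \<sigma> x \<cdot> \<tau>)"
  by (induction t) auto

lemma vars_subst: "vars (t \<cdot> \<sigma>) = (\<Union>x\<in>vars t. vars (\<sigma> x))"
  by (induction t) auto

lemma linear_Fun_nth: "linear_trm (Fun f ts) \<Longrightarrow> i < length ts \<Longrightarrow> linear_trm (ts ! i)"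
  unfolding linear_trm_def
proof (intro allI impI, goal_cases)
  case (1 p q x)
  then have "i # p = i # q" by (metis is_pos.simps(3) subt_at.simps(3))
  then show ?case by simp
qed

lemma linear_Fun_disjoint:
  assumes "linear_trm (Fun f ts)" "i < length ts" "j < length ts" "x \<in> vars (ts ! i)" "x \<in> vars (ts ! j)"
  shows "i = j"
proof -
  obtain p q where "is_pos (ts ! i) p" "subt_at (ts ! i) p = Var x" "is_pos (ts ! j) q" "subt_at (ts ! j) q = Var x"
    using assms(4,5) by (auto simp: vars_def)
  then have "i # p = j # q" using assms(1-3) unfolding linear_trm_def by (metis is_pos.simps(3) subt_at.simps(3))
  then show ?thesis by simp
qed

lemma subt_at_subst: "is_pos t p \<Longrightarrow> subt_at (t \<cdot> \<sigma>) p = subt_at t p \<cdot> \<sigma>"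
  by (induction t p rule: subt_at.induct) auto

lemma is_pos_subst: "is_pos t p \<Longrightarrow> is_pos (t \<cdot> \<sigma>) p"
  by (induction t p rule: is_pos.induct) auto

lemma replace_at_subst: "is_pos t p \<Longrightarrow> replace_at t p u \<cdot> \<sigma> = replace_at (t \<cdot> \<sigma>) p (u \<cdot> \<sigma>)"
  by (induction t p u rule: replace_at.induct) (auto simp: map_update)

lemma vars_subt_at: "is_pos t p \<Longrightarrow> vars (subt_at t p) \<subseteq> vars t"
  by (induction t p rule: subt_at.induct) (auto, metis nth_mem subsetD)

section \<open>Existence of idempotent most general unifiers\<close>

section \<open>Unification\<close>

definition vars_eqs :: "(('f, 'v) trm \<times> ('f, 'v) trm) set \<Rightarrow> 'v set" where
  "vars_eqs E = (\<Union>(s, t)\<in>E. vars s \<union> vars t)"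

lemma vars_eqs_simps [simp]:
  "vars_eqs {} = {}"
  "vars_eqs (insert (s, t) E) = vars s \<union> vars t \<union> vars_eqs E"
  "vars_eqs (E \<union> E') = vars_eqs E \<union> vars_eqs E'"
  by (auto simp: vars_eqs_def)

lemma unifier_simps [simp]:
  "unifier \<sigma> {}"
  "unifier \<sigma> (insert (s, t) E) \<longleftrightarrow> s \<cdot> \<sigma> = t \<cdot> \<sigma> \<and> unifier \<sigma> E"
  "unifier \<sigma> (E \<union> E') \<longleftrightarrow> unifier \<sigma> E \<and> unifier \<sigma> E'"
  by (auto simp: unifier_def)

text \<open>Stronger than \<open>mgu\<close>: every unifier factors through \<open>\<sigma>\<close>
  with itself as second factor, and \<open>\<sigma>\<close> fixes all variables outside the
  equations and introduces no new ones. This controls which variables of an overlap a step inside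
  the substitution can affect.\<close>

definition idem_mgu :: "('f, 'v) subst \<Rightarrow> (('f, 'v) trm \<times> ('f, 'v) trm) set \<Rightarrow> bool" where
  "idem_mgu \<sigma> E \<longleftrightarrow> unifier \<sigma> E \<and> (\<forall>\<tau>. unifier \<tau> E \<longrightarrow> (\<forall>x. \<sigma> x \<cdot> \<tau> = \<tau> x))
     \<and> (\<forall>x. x \<notin> vars_eqs E \<longrightarrow> \<sigma> x = Var x) \<and> (\<forall>x \<in> vars_eqs E. vars (\<sigma> x) \<subseteq> vars_eqs E)"

lemma size_subst_var: "x \<in> vars t \<Longrightarrow> size (\<sigma> x) \<le> size (t \<cdot> \<sigma>)"
proof (induction t)
  case (Fun f ts)
  then obtain t where t: "t \<in> set ts" "x \<in> vars t" by auto
  then have "size (\<sigma> x) \<le> size (t \<cdot> \<sigma>)" using Fun.IH by blast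
  also have "\<dots> \<le> size_list size (map (\<lambda>t. t \<cdot> \<sigma>) ts)"
    by (rule size_list_estimation'[of "t \<cdot> \<sigma>"]) (use t in auto)
  finally show ?case by simp
qed simp

text \<open>A proper occurrence of \<open>x\<close> in \<open>t\<close> would make
  \<open>\<sigma> x\<close> strictly smaller than \<open>t \<cdot> \<sigma>\<close>.\<close>

lemma occurs_check:
  assumes "x \<in> vars t" "\<sigma> x = t \<cdot> \<sigma>"
  shows "t = Var x"
proof (cases t)
  case (Fun f ts)
  then obtain s where s: "s \<in> set ts" "x \<in> vars s" using assms(1) by auto
  then have "size (\<sigma> x) \<le> size (s \<cdot> \<sigma>)" by (simp add: size_subst_var)
  also have "\<dots> \<le> size_list size (map (\<lambda>t. t \<cdot> \<sigma>) ts)"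
    by (rule size_list_estimation'[of "s \<cdot> \<sigma>"]) (use s in auto)
  also have "\<dots> < size (t \<cdot> \<sigma>)" using Fun by simp
  finally show ?thesis using assms(2) by simp
qed (use assms in auto)

abbreviation subst_eqs :: "(('f, 'v) trm \<times> ('f, 'v) trm) list \<Rightarrow> ('f, 'v) subst \<Rightarrow> (('f, 'v) trm \<times> ('f, 'v) trm) list" where
  "subst_eqs E \<sigma> \<equiv> map (\<lambda>(s, t). (s \<cdot> \<sigma>, t \<cdot> \<sigma>)) E"

lemma unifier_subst_eqs: "unifier \<tau> (set (subst_eqs E \<sigma>)) \<longleftrightarrow> unifier (\<lambda>x. \<sigma> x \<cdot> \<tau>) (set E)"
  by (auto simp: unifier_def subst_subst split: prod.splits)

lemma vars_eqs_eliminate: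
  assumes "x \<notin> vars t"
  shows "vars_eqs (set (subst_eqs E (Var(x := t)))) \<subseteq> vars t \<union> vars_eqs (set E) - {x}"
proof -
  have "vars (s \<cdot> Var(x := t)) \<subseteq> vars t \<union> vars s - {x}" for s
    using assms by (auto simp: vars_subst split: if_splits)
  then show ?thesis unfolding vars_eqs_def by fastforce
qed

text \<open>A unifier of \<open>x\<close> and \<open>t\<close> does not change when the binding of
  \<open>x\<close> to \<open>t\<close> is applied before it, so it unifies \<open>E\<close> exactly
  if it unifies \<open>E\<close> with \<open>x\<close> eliminated.\<close>

lemma idem_mgu_eliminate:
  assumes x: "x \<notin> vars t" and \<sigma>: "idem_mgu \<sigma> (set (subst_eqs E (Var(x := t))))"
  shows "idem_mgu (\<lambda>y. (Var(x := t)) y \<cdot> \<sigma>) (insert (Var x, t) (set E))"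
proof -
  let ?s = "Var(x := t)"
  let ?E = "set (subst_eqs E ?s)"
  have id: "u \<cdot> ?s = u" if "x \<notin> vars u" for u using that subst_cong[of u ?s Var] by (metis fun_upd_other subst_Var)
  have V: "vars_eqs ?E \<subseteq> vars t \<union> vars_eqs (set E) - {x}" by (rule vars_eqs_eliminate[OF x])
  have u: "unifier \<sigma> ?E" and mg: "\<And>\<tau> y. unifier \<tau> ?E \<Longrightarrow> \<sigma> y \<cdot> \<tau> = \<tau> y"
    and out: "\<And>y. y \<notin> vars_eqs ?E \<Longrightarrow> \<sigma> y = Var y"
    and ran: "\<And>y. y \<in> vars_eqs ?E \<Longrightarrow> vars (\<sigma> y) \<subseteq> vars_eqs ?E"
    using \<sigma> unfolding idem_mgu_def by auto
  have ran': "vars (\<sigma> y) \<subseteq> insert y (vars_eqs ?E)" for y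
    using out[of y] ran[of y] by (cases "y \<in> vars_eqs ?E") auto
  have unif: "unifier (\<lambda>y. ?s y \<cdot> \<sigma>) (insert (Var x, t) (set E))"
    using u[unfolded unifier_subst_eqs] id[OF x] by (simp add: subst_subst[symmetric] del: fun_upd_apply) simp
  have mgu: "?s y \<cdot> \<sigma> \<cdot> \<tau> = \<tau> y" if "unifier \<tau> (insert (Var x, t) (set E))" for \<tau> y
  proof -
    have eq: "(\<lambda>y. ?s y \<cdot> \<tau>) = \<tau>" using that by auto
    then have "unifier \<tau> ?E" using that by (simp only: unifier_subst_eqs unifier_simps)
    then have "?s y \<cdot> \<sigma> \<cdot> \<tau> = ?s y \<cdot> \<tau>" using mg by (simp add: subst_subst del: fun_upd_apply)
    also have "\<dots> = \<tau> y" using eq by metis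
    finally show ?thesis .
  qed
  have out': "?s y \<cdot> \<sigma> = Var y" if "y \<notin> vars_eqs (insert (Var x, t) (set E))" for y
    using that out[of y] V by auto
  have "vars (?s y \<cdot> \<sigma>) \<subseteq> vars_eqs (insert (Var x, t) (set E))"
    if "y \<in> vars_eqs (insert (Var x, t) (set E))" for y
    using that ran' V by (auto simp: vars_subst split: if_splits)
  then show ?thesis unfolding idem_mgu_def using unif mgu out' by blast
qed

text \<open>Elimination of a variable shrinks the variable set; decomposition and deletion do not
  enlarge it and shrink the total size of the left-hand sides, where one extra unit per equation
  makes every deletion count. The given unifier \<open>\<tau>\<close> rules out clashes and failing
  occurs checks.\<close>

lemma ex_idem_mgu:
  fixes E :: "(('f, 'v) trm \<times> ('f, 'v) trm) list"
  assumes "unifier \<tau> (set E)"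
  shows "\<exists>\<sigma>. idem_mgu \<sigma> (set E)"
  using assms
proof (induction E rule: wf_induct[OF wf_measures, of "[\<lambda>E. card (vars_eqs (set E)), \<lambda>E. \<Sum>(s, t)\<leftarrow>E. Suc (size s)]"])
  case (1 E)
  have fin: "finite (vars_eqs (set E))" for E :: "(('f, 'v) trm \<times> ('f, 'v) trm) list"
    by (auto simp: vars_eqs_def)
  have IH: "\<exists>\<sigma>. idem_mgu \<sigma> (set E')" if "unifier \<tau> (set E')" "vars_eqs (set E') \<subseteq> vars_eqs (set E)"
    "vars_eqs (set E') \<noteq> vars_eqs (set E) \<or> (\<Sum>(s, t)\<leftarrow>E'. Suc (size s)) < (\<Sum>(s, t)\<leftarrow>E. Suc (size s))" for E'
  proof -
    have "card (vars_eqs (set E')) < card (vars_eqs (set E)) \<or> vars_eqs (set E') = vars_eqs (set E)"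
      using that(2) psubset_card_mono[OF fin[of E]] by blast
    then show ?thesis using 1 that by (auto simp: case_prod_unfold)
  qed
  have elim: "\<exists>\<sigma>. idem_mgu \<sigma> (insert (Var x, t) (set E'))"
    if x: "vars_eqs (set E) = insert x (vars t \<union> vars_eqs (set E'))" "x \<notin> vars t" "\<tau> x = t \<cdot> \<tau>" "unifier \<tau> (set E')" for x t E'
  proof -
    have eq: "(\<lambda>y. (Var(x := t)) y \<cdot> \<tau>) = \<tau>" using x by auto
    then have "unifier \<tau> (set (subst_eqs E' (Var(x := t))))" using x by (simp only: unifier_subst_eqs)
    moreover have "vars_eqs (set (subst_eqs E' (Var(x := t)))) \<subseteq> vars_eqs (set E) - {x}"
      using vars_eqs_eliminate[OF x(2), of E'] x(1) by blast
    ultimately obtain \<sigma> where "idem_mgu \<sigma> (set (subst_eqs E' (Var(x := t))))"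
      using IH[of "subst_eqs E' (Var(x := t))"] x(1) by blast
    then show ?thesis using idem_mgu_eliminate[OF x(2)] by blast
  qed
  show ?case
  proof (cases E)
    case Nil
    then show ?thesis by (auto simp: idem_mgu_def intro: exI[of _ Var])
  next
    case (Cons e E')
    obtain s t where e: "e = (s, t)" by (cases e)
    have E: "set E = insert (s, t) (set E')" using Cons e by simp
    have u: "s \<cdot> \<tau> = t \<cdot> \<tau>" "unifier \<tau> (set E')" using 1 E by auto
    show ?thesis
    proof (cases "s = t")
      case True
      then obtain \<sigma> where \<sigma>: "idem_mgu \<sigma> (set E')" using IH[of E'] u Cons e by auto
      have "idem_mgu \<sigma> (set E)" using \<sigma> True unfolding E idem_mgu_def by auto
      then show ?thesis by blast
    next
      case False
      show ?thesis
      proof (cases s)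
        case (Var x)
        then have "x \<notin> vars t" using occurs_check[of x t \<tau>] u(1) False by auto
        then show ?thesis using elim[of x t E'] u Var unfolding E by auto
      next
        case s: (Fun f ss)
        show ?thesis
        proof (cases t)
          case (Var x)
          then have "x \<notin> vars s" using occurs_check[of x s \<tau>] u(1) False by auto
          then obtain \<sigma> where "idem_mgu \<sigma> (insert (Var x, s) (set E'))"
            using elim[of x s E'] u Var unfolding E by auto
          then have "idem_mgu \<sigma> (set E)" unfolding E Var idem_mgu_def by (auto simp: eq_commute[of "s \<cdot> _"])
          then show ?thesis by blast
        next
          case t: (Fun g ts)
          have fg: "f = g" and map: "map (\<lambda>s. s \<cdot> \<tau>) ss = map (\<lambda>t. t \<cdot> \<tau>) ts" using u(1) s t by auto
          have len: "length ss = length ts" using map by (metis length_map)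
          let ?E = "zip ss ts @ E'"
          have eqv: "unifier \<sigma> (set E) \<longleftrightarrow> unifier \<sigma> (set ?E)" for \<sigma>
            using len unfolding E s t fg
            by (auto simp: unifier_def set_zip list_eq_iff_nth_eq)
          have veq: "vars_eqs (set ?E) = vars_eqs (set E)"
          proof -
            have "vars_eqs (set (zip ss ts)) = vars s \<union> vars t"
              using len unfolding s t by (induction ss ts rule: list_induct2) auto
            then show ?thesis unfolding E by simp
          qed
          have "(\<Sum>(s, t)\<leftarrow>zip ss ts. Suc (size s)) = size_list size ss"
            using len by (induction ss ts rule: list_induct2) auto
          then have "(\<Sum>(s, t)\<leftarrow>?E. Suc (size s)) < (\<Sum>(s, t)\<leftarrow>E. Suc (size s))"
            using Cons e s by simp
          then obtain \<sigma> where "idem_mgu \<sigma> (set ?E)" using IH[of ?E] eqv veq 1 by auto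
          then have "idem_mgu \<sigma> (set E)" unfolding idem_mgu_def veq eqv .
          then show ?thesis by blast
        qed
      qed
    qed
  qed
qed

section \<open>Simultaneous replacement as a function\<close>

section \<open>Parallel replacement\<close>

text \<open>Recursion on the term takes the place of the list hidden in \<open>par_replace\<close>,
  so that inductions can split a set of positions along the arguments.\<close>

function (sequential) par_repl :: "('f, 'v) trm \<Rightarrow> pos set \<Rightarrow> (pos \<Rightarrow> ('f, 'v) trm) \<Rightarrow> ('f, 'v) trm" where
  "par_repl (Var x) P f = (if [] \<in> P then f [] else Var x)"
| "par_repl (Fun g ts) P f = (if [] \<in> P then f []
     else Fun g (map (\<lambda>i. par_repl (ts ! i) {p. i # p \<in> P} (\<lambda>p. f (i # p))) [0..<length ts]))"
  by pat_completeness auto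
termination
  by (relation "measure (\<lambda>(t, _). size t)") (auto simp: less_Suc_eq_le intro!: size_list_estimation')

lemma par_repl_root [simp]: "[] \<in> P \<Longrightarrow> par_repl s P f = f []"
  by (cases s) auto

lemma par_repl_empty [simp]: "par_repl s {} f = s"
proof (induction s arbitrary: f)
  case (Fun g ts)
  then show ?case by (auto intro: nth_equalityI)
qed simp

lemma par_repl_cong:
  assumes "s = s'" "P = P'" "\<And>p. p \<in> P' \<Longrightarrow> f p = f' p"
  shows "par_repl s P f = par_repl s' P' f'"
  using assms(3) unfolding assms(1,2)
  by (induction s' P' f arbitrary: f' rule: par_repl.induct) auto

lemma pairwise_par_root: "pairwise_par P \<Longrightarrow> [] \<in> P \<Longrightarrow> P = {[]}"
  unfolding pairwise_par_def par_pos_def by force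

lemma pairwise_par_arg: "pairwise_par P \<Longrightarrow> pairwise_par {p. i # p \<in> P}"
  unfolding pairwise_par_def par_pos_def by fastforce

lemma pairwise_par_subset: "pairwise_par P \<Longrightarrow> Q \<subseteq> P \<Longrightarrow> pairwise_par Q"
  unfolding pairwise_par_def by blast

text \<open>A replacement at \<open>p\<close> disturbs no parallel position. The case
  \<open>p \<in> P\<close> is included because a list of successive replacements may repeat a
  position.\<close>

lemma replace_at_par_repl:
  "pairwise_par (insert p P) \<Longrightarrow> replace_at (par_repl s P f) p (f p) = par_repl s (insert p P) f"
proof (induction p arbitrary: s P f)
  case (Cons i q)
  have nil: "[] \<notin> P" using pairwise_par_root[OF Cons.prems] by auto
  show ?case
  proof (cases s)
    case (Var x)
    then show ?thesis using nil by simp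
  next
    case (Fun g ts)
    have ins: "{p. i # p \<in> insert (i # q) P} = insert q {p. i # p \<in> P}" by auto
    have "replace_at (par_repl (ts ! i) {p. i # p \<in> P} (\<lambda>p. f (i # p))) q (f (i # q)) =
       par_repl (ts ! i) {p. i # p \<in> insert (i # q) P} (\<lambda>p. f (i # p))"
      using Cons.IH[of "{p. i # p \<in> P}" "ts ! i" "\<lambda>p. f (i # p)"] pairwise_par_arg[OF Cons.prems, of i]
      unfolding ins by simp
    moreover have "{p. j # p \<in> insert (i # q) P} = {p. j # p \<in> P}" if "j \<noteq> i" for j using that by auto
    ultimately show ?thesis using nil unfolding Fun
      by (cases "i < length ts") (auto intro!: nth_equalityI simp: nth_list_update)
  qed
qed simp

lemma foldr_replace_at:
  "pairwise_par (set ps) \<Longrightarrow> foldr (\<lambda>p u. replace_at u p (f p)) ps s = par_repl s (set ps) f"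
proof (induction ps)
  case (Cons p ps)
  then have "pairwise_par (set ps)" using pairwise_par_subset by (metis set_subset_Cons)
  then show ?case using Cons replace_at_par_repl[of p "set ps" s f] by simp
qed simp

lemma par_replace_iff:
  assumes "pairwise_par P"
  shows "par_replace s P f t \<longleftrightarrow> finite P \<and> t = par_repl s P f"
proof
  show "finite P \<and> t = par_repl s P f" if "par_replace s P f t"
    using that assms foldr_replace_at unfolding par_replace_def by blast
  assume "finite P \<and> t = par_repl s P f"
  moreover then obtain ps where "set ps = P" using finite_list by blast
  ultimately show "par_replace s P f t"
    using assms foldr_replace_at[of ps f s] unfolding par_replace_def by metis
qed

lemma par_repl_subst:
  "(\<And>p. p \<in> P \<Longrightarrow> is_pos s p) \<Longrightarrow> par_repl s P f \<cdot> \<sigma> = par_repl (s \<cdot> \<sigma>) P (\<lambda>p. f p \<cdot> \<sigma>)"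
proof (induction s P f rule: par_repl.induct)
  case (1 x P f)
  then have "[] \<notin> P \<Longrightarrow> P = {}" by (metis all_not_in_conv is_pos_Var)
  then show ?case by (cases "[] \<in> P") auto
next
  case (2 g ts P f)
  show ?case
  proof (cases "[] \<in> P")
    case False
    have "par_repl (ts ! i) {p. i # p \<in> P} (\<lambda>p. f (i # p)) \<cdot> \<sigma> =
      par_repl (ts ! i \<cdot> \<sigma>) {p. i # p \<in> P} (\<lambda>p. f (i # p) \<cdot> \<sigma>)" if "i < length ts" for i
      using 2(1)[OF False, of i] 2(2) that by force
    then show ?thesis using False by simp
  qed simp
qed

section \<open>Parallel rewriting without positions, and its closure properties\<close>

section \<open>Parallel steps by structural recursion\<close>

text \<open>This form allows induction on terms. It contains \<open>rstep R\<close> and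
  \<open>par_step R\<close> and is contained in \<open>(rstep R)\<^sup>*\<close>, which is what the
  transfer from and to rewriting relies on.\<close>

inductive_set pstep :: "('f, 'v) rule set \<Rightarrow> (('f, 'v) trm \<times> ('f, 'v) trm) set" for R where
  pstep_Var: "(Var x, Var x) \<in> pstep R"
| pstep_Fun: "length ss = length ts \<Longrightarrow> (\<And>i. i < length ts \<Longrightarrow> (ss ! i, ts ! i) \<in> pstep R) \<Longrightarrow>
    (Fun f ss, Fun f ts) \<in> pstep R"
| pstep_root: "(l, r) \<in> R \<Longrightarrow> (l \<cdot> \<mu>, r \<cdot> \<mu>) \<in> pstep R"

lemma pstep_subst:
  "(\<And>x. x \<in> vars t \<Longrightarrow> (\<sigma> x, \<tau> x) \<in> pstep R) \<Longrightarrow> (t \<cdot> \<sigma>, t \<cdot> \<tau>) \<in> pstep R"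
proof (induction t)
  case (Fun f ts)
  have "(ts ! i \<cdot> \<sigma>, ts ! i \<cdot> \<tau>) \<in> pstep R" if "i < length ts" for i
    using Fun.IH[of "ts ! i"] Fun.prems that by (metis UN_I nth_mem vars_Fun)
  then show ?case by (auto intro: pstep_Fun)
qed simp

lemma pstep_refl [simp]: "(t, t) \<in> pstep R"
  using pstep_subst[of t Var Var R] by (simp add: pstep_Var)

lemma pstep_mono: assumes "R \<subseteq> S" shows "pstep R \<subseteq> pstep S"
proof (rule subrelI)
  fix s t assume "(s, t) \<in> pstep R"
  then show "(s, t) \<in> pstep S"
    by (induction rule: pstep.induct) (use assms in \<open>auto intro: pstep.intros\<close>)
qed

lemma pstep_closed_subst: "(s, t) \<in> pstep R \<Longrightarrow> (s \<cdot> \<sigma>, t \<cdot> \<sigma>) \<in> pstep R"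
proof (induction rule: pstep.induct)
  case (pstep_Fun ss ts f)
  then show ?case by (auto intro: pstep.pstep_Fun)
next
  case (pstep_root l r \<mu>)
  then show ?case by (simp add: subst_subst pstep.pstep_root)
qed simp

lemma rstep_root: "(l, r) \<in> R \<Longrightarrow> (l \<cdot> \<mu>, r \<cdot> \<mu>) \<in> rstep R"
  unfolding rstep_def
  by (intro CollectI case_prodI exI[of _ "[]"] exI[of _ l] exI[of _ r] exI[of _ \<mu>]) simp

lemma rstep_ctxt:
  assumes "(s, t) \<in> rstep R"
  shows "(Fun f (us @ s # vs), Fun f (us @ t # vs)) \<in> rstep R"
proof -
  obtain p l r \<sigma> where "(l, r) \<in> R" "is_pos s p" "subt_at s p = l \<cdot> \<sigma>" "t = replace_at s p (r \<cdot> \<sigma>)"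
    using assms unfolding rstep_def by blast
  then show ?thesis unfolding rstep_def
    by (intro CollectI case_prodI exI[of _ "length us # p"] exI[of _ l] exI[of _ r] exI[of _ \<sigma>]) simp
qed

lemma rstep_subst:
  assumes "(s, t) \<in> rstep R"
  shows "(s \<cdot> \<sigma>, t \<cdot> \<sigma>) \<in> rstep R"
proof -
  obtain p l r \<mu> where "(l, r) \<in> R" "is_pos s p" "subt_at s p = l \<cdot> \<mu>" "t = replace_at s p (r \<cdot> \<mu>)"
    using assms unfolding rstep_def by blast
  then show ?thesis unfolding rstep_def
    by (intro CollectI case_prodI exI[of _ p] exI[of _ l] exI[of _ r] exI[of _ "\<lambda>x. \<mu> x \<cdot> \<sigma>"])
      (simp add: replace_at_subst is_pos_subst subt_at_subst subst_subst)
qed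

lemma rstep_subset_pstep: "rstep R \<subseteq> pstep R"
proof (rule subrelI)
  fix s t assume "(s, t) \<in> rstep R"
  then obtain p l r \<sigma> where "(l, r) \<in> R" "is_pos s p" "subt_at s p = l \<cdot> \<sigma>" "t = replace_at s p (r \<cdot> \<sigma>)"
    unfolding rstep_def by blast
  then show "(s, t) \<in> pstep R"
  proof (induction p arbitrary: s t)
    case Nil
    then show ?case by (simp add: pstep_root)
  next
    case (Cons i p)
    obtain f ss where s: "s = Fun f ss" using Cons.prems by (cases s) auto
    have "(ss ! i, replace_at (ss ! i) p (r \<cdot> \<sigma>)) \<in> pstep R" using Cons s by simp
    then show ?case using Cons.prems s by (auto intro!: pstep_Fun simp: nth_list_update)
  qed
qed

text \<open>Closure under changing all arguments at once. It is stable under converse and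
  composition, so a diagram for a compound term can be assembled from diagrams for its
  arguments.\<close>

definition args_closed :: "(('f, 'v) trm \<times> ('f, 'v) trm) set \<Rightarrow> bool" where
  "args_closed r \<longleftrightarrow> (\<forall>f ss ts. length ss = length ts \<longrightarrow> (\<forall>i<length ts. (ss ! i, ts ! i) \<in> r) \<longrightarrow> (Fun f ss, Fun f ts) \<in> r)"

lemma args_closed_pstep: "args_closed (pstep R)"
  unfolding args_closed_def by (auto intro: pstep_Fun)

lemma args_closed_converse: "args_closed r \<Longrightarrow> args_closed (r\<inverse>)"
  unfolding args_closed_def by auto

lemma args_closed_relcomp:
  assumes "args_closed r" "args_closed q"
  shows "args_closed (r O q)"
  unfolding args_closed_def
proof (intro allI impI)
  fix f and ss ts :: "('a, 'b) trm list"
  assume len: "length ss = length ts" and "\<forall>i<length ts. (ss ! i, ts ! i) \<in> r O q"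
  then have "\<forall>i\<in>{..<length ts}. \<exists>u. (ss ! i, u) \<in> r \<and> (u, ts ! i) \<in> q" by blast
  then obtain g where g: "\<forall>i\<in>{..<length ts}. (ss ! i, g i) \<in> r \<and> (g i, ts ! i) \<in> q"
    unfolding bchoice_iff by blast
  have "(Fun f ss, Fun f (map g [0..<length ts])) \<in> r" "(Fun f (map g [0..<length ts]), Fun f ts) \<in> q"
    using assms g len unfolding args_closed_def by simp_all
  then show "(Fun f ss, Fun f ts) \<in> r O q" by blast
qed

text \<open>The arguments are rewritten from left to right; in the induction \<open>us\<close>
  collects those already treated.\<close>

lemma args_closed_rtrancl:
  assumes ctxt: "\<And>f us s t vs. (s, t) \<in> r \<Longrightarrow> (Fun f (us @ s # vs), Fun f (us @ t # vs)) \<in> r"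
  shows "args_closed (r\<^sup>*)"
  unfolding args_closed_def
proof (intro allI impI)
  fix f and ss ts :: "('a, 'b) trm list"
  have ctxts: "(Fun f (us @ s # vs), Fun f (us @ t # vs)) \<in> r\<^sup>*" if "(s, t) \<in> r\<^sup>*" for us s t vs
    using that by (induction rule: rtrancl_induct) (auto intro: ctxt rtrancl_into_rtrancl)
  assume "length ss = length ts" and "\<forall>i<length ts. (ss ! i, ts ! i) \<in> r\<^sup>*"
  then have "(Fun f (us @ ss), Fun f (us @ ts)) \<in> r\<^sup>*" for us
  proof (induction ss ts arbitrary: us rule: list_induct2)
    case (Cons s ss t ts)
    have "(s, t) \<in> r\<^sup>*" "\<forall>i<length ts. (ss ! i, ts ! i) \<in> r\<^sup>*" using Cons.prems by force+
    then show ?case using ctxts[of s t us ss] Cons.IH[of "us @ [t]"] by simp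
  qed simp
  from this[of "[]"] show "(Fun f ss, Fun f ts) \<in> r\<^sup>*" by simp
qed

lemma pstep_subset_rsteps: "pstep R \<subseteq> (rstep R)\<^sup>*"
proof (rule subrelI)
  fix s t assume "(s, t) \<in> pstep R"
  then show "(s, t) \<in> (rstep R)\<^sup>*"
  proof (induction rule: pstep.induct)
    case (pstep_Fun ss ts f)
    then show ?case using args_closed_rtrancl[OF rstep_ctxt, of R] unfolding args_closed_def by blast
  qed (auto intro: rstep_root)
qed

lemma rtrancl_pstep: "(pstep R)\<^sup>* = (rstep R)\<^sup>*"
  using rstep_subset_pstep pstep_subset_rsteps by (rule rtrancl_subset[symmetric, THEN sym])

text \<open>The variable condition says that the redexes contracted at \<open>P\<close> are instantiated alike by
  \<open>\<gamma>\<close> and \<open>\<gamma>'\<close>, so the step at \<open>P\<close> and the steps inside the substitution are parallel.\<close>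

lemma par_step_at_subst:
  assumes "par_step_at R P w v" "\<And>x. (\<gamma> x, \<gamma>' x) \<in> pstep R" "\<And>x. x \<in> vars_at v P \<Longrightarrow> \<gamma> x = \<gamma>' x"
  shows "(w \<cdot> \<gamma>, v \<cdot> \<gamma>') \<in> pstep R"
  using assms
proof (induction w arbitrary: P v)
  case (Var x)
  have par: "pairwise_par P" and P: "P \<subseteq> {[]}" using Var.prems(1) unfolding par_step_at_def poss_def by auto
  show ?case
  proof (cases "[] \<in> P")
    case True
    \<comment> \<open>A redex at the root puts all of \<open>v\<close> below \<open>P\<close>, so
      \<open>\<gamma>\<close> and \<open>\<gamma>'\<close> agree on \<open>v\<close> and one root
      step suffices.\<close>
    then obtain l r \<mu> where "(l, r) \<in> R" "Var x = l \<cdot> \<mu>" "v = r \<cdot> \<mu>"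
      using Var.prems(1) unfolding par_step_at_def by (metis subt_at.simps(1))
    moreover have "v \<cdot> \<gamma>' = v \<cdot> \<gamma>" by (rule subst_cong) (use Var.prems(3) True in \<open>force simp: vars_at_def\<close>)
    ultimately show ?thesis using pstep_root[of l r R] by (metis subst_subst)
  next
    case False
    then have "P = {}" using P by auto
    then have "v = Var x"
      using Var.prems(1) par_replace_iff[OF par, of "Var x" "subt_at v" v] by (simp add: par_step_at_def)
    then show ?thesis using Var.prems(2) by simp
  qed
next
  case (Fun f ws)
  have par: "pairwise_par P" and P: "P \<subseteq> poss (Fun f ws)" using Fun.prems(1) unfolding par_step_at_def by blast+
  have fin: "finite P" and v: "v = par_repl (Fun f ws) P (subt_at v)"
    using Fun.prems(1) par_replace_iff[OF par, of "Fun f ws" "subt_at v" v] unfolding par_step_at_def by blast+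
  show ?case
  proof (cases "[] \<in> P")
    case True
    then obtain l r \<mu> where "(l, r) \<in> R" "Fun f ws = l \<cdot> \<mu>" "v = r \<cdot> \<mu>"
      using Fun.prems(1) unfolding par_step_at_def by (metis subt_at.simps(1))
    moreover have "v \<cdot> \<gamma>' = v \<cdot> \<gamma>" by (rule subst_cong) (use Fun.prems(3) True in \<open>force simp: vars_at_def\<close>)
    ultimately show ?thesis using pstep_root[of l r R] by (metis subst_subst)
  next
    case False
    define vs where "vs = map (\<lambda>i. par_repl (ws ! i) {p. i # p \<in> P} (\<lambda>p. subt_at v (i # p))) [0..<length ws]"
    have vs: "v = Fun f vs" using v False unfolding vs_def by simp
    have len: "length vs = length ws" by (simp add: vs_def)
    have "(ws ! i \<cdot> \<gamma>, vs ! i \<cdot> \<gamma>') \<in> pstep R" if i: "i < length ws" for i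
    proof (rule Fun.IH)
      show "ws ! i \<in> set ws" using i by simp
      show "par_step_at R {p. i # p \<in> P} (ws ! i) (vs ! i)"
        unfolding par_step_at_def
      proof (intro conjI ballI)
        show "{p. i # p \<in> P} \<subseteq> poss (ws ! i)" using P by (auto simp: poss_def)
        show par': "pairwise_par {p. i # p \<in> P}" by (rule pairwise_par_arg[OF par])
        have "finite {p. i # p \<in> P}" using finite_vimageI[OF fin, of "Cons i"] by (simp add: vimage_def)
        moreover have "vs ! i = par_repl (ws ! i) {p. i # p \<in> P} (\<lambda>p. subt_at v (i # p))"
          using i by (simp add: vs_def)
        then have "vs ! i = par_repl (ws ! i) {p. i # p \<in> P} (subt_at (vs ! i))"
          by (simp add: vs)
        ultimately show "par_replace (ws ! i) {p. i # p \<in> P} (subt_at (vs ! i)) (vs ! i)"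
          using par_replace_iff[OF par'] by blast
        fix p assume "p \<in> {p. i # p \<in> P}"
        then have "\<exists>l r \<mu>. (l, r) \<in> R \<and> subt_at (Fun f ws) (i # p) = l \<cdot> \<mu> \<and> subt_at v (i # p) = r \<cdot> \<mu>"
          using Fun.prems(1) unfolding par_step_at_def by blast
        then show "\<exists>l r \<mu>. (l, r) \<in> R \<and> subt_at (ws ! i) p = l \<cdot> \<mu> \<and> subt_at (vs ! i) p = r \<cdot> \<mu>"
          unfolding vs by simp
      qed
      show "\<And>x. (\<gamma> x, \<gamma>' x) \<in> pstep R" by fact
      fix x assume "x \<in> vars_at (vs ! i) {p. i # p \<in> P}"
      then have "x \<in> vars_at v P" unfolding vs vars_at_def by force
      then show "\<gamma> x = \<gamma>' x" by fact
    qed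
    then show ?thesis unfolding vs using len by (auto intro: pstep_Fun)
  qed
qed

lemma par_step_subset_pstep: "par_step R \<subseteq> pstep R"
  using par_step_at_subst[of R _ _ _ Var Var] by (auto simp: par_step_def)

section \<open>Parallel peaks in which one step is at the root\<close>

section \<open>Critical peaks\<close>

text \<open>Descending into \<open>l\<close>, the parallel step either meets a redex at a function
  position, which is recorded in \<open>P\<close>, or reaches a variable and becomes a step of the
  substitution. By linearity no variable receives two different values, and below a redex nothing
  else is contracted, so \<open>\<tau>'\<close> can stay \<open>\<tau>\<close> there.\<close>

lemma pstep_linear_decompose:
  assumes "linear_trm l" "(l \<cdot> \<tau>, t) \<in> pstep R"
  shows "\<exists>P \<rho> \<mu> \<tau>'. finite P \<and> P \<subseteq> funposs l \<and> pairwise_par P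
    \<and> (\<forall>p\<in>P. \<rho> p \<in> R \<and> subt_at l p \<cdot> \<tau> = fst (\<rho> p) \<cdot> \<mu> p)
    \<and> (\<forall>x. (\<tau> x, \<tau>' x) \<in> pstep R) \<and> (\<forall>x\<in>vars_at l P. \<tau>' x = \<tau> x)
    \<and> t = par_repl (l \<cdot> \<tau>') P (\<lambda>p. snd (\<rho> p) \<cdot> \<mu> p)"
  using assms
proof (induction l arbitrary: t)
  case (Var x)
  then show ?case
    by (intro exI[of _ "{}"] exI[of _ undefined] exI[of _ "\<tau>(x := t)"]) (auto simp: pairwise_par_def vars_at_def)
next
  case (Fun f ls)
  from Fun.prems(2) show ?case
  proof (cases rule: pstep.cases)
    case (pstep_Fun ss ts g)
    let ?n = "length ls"
    have eqs: "g = f" "ss = map (\<lambda>l. l \<cdot> \<tau>) ls" "t = Fun f ts" "length ts = ?n" using pstep_Fun by auto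
    have "\<forall>i\<in>{..<?n}. \<exists>P \<rho> \<mu> \<tau>'. finite P \<and> P \<subseteq> funposs (ls ! i) \<and> pairwise_par P
      \<and> (\<forall>p\<in>P. \<rho> p \<in> R \<and> subt_at (ls ! i) p \<cdot> \<tau> = fst (\<rho> p) \<cdot> \<mu> p)
      \<and> (\<forall>x. (\<tau> x, \<tau>' x) \<in> pstep R) \<and> (\<forall>x\<in>vars_at (ls ! i) P. \<tau>' x = \<tau> x)
      \<and> ts ! i = par_repl (ls ! i \<cdot> \<tau>') P (\<lambda>p. snd (\<rho> p) \<cdot> \<mu> p)"
    proof
      fix i assume "i \<in> {..<?n}"
      then have i: "i < ?n" by simp
      have "(ls ! i \<cdot> \<tau>, ts ! i) \<in> pstep R" using pstep_Fun(4)[of i] i eqs by simp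
      then show "\<exists>P \<rho> \<mu> \<tau>'. finite P \<and> P \<subseteq> funposs (ls ! i) \<and> pairwise_par P
        \<and> (\<forall>p\<in>P. \<rho> p \<in> R \<and> subt_at (ls ! i) p \<cdot> \<tau> = fst (\<rho> p) \<cdot> \<mu> p)
        \<and> (\<forall>x. (\<tau> x, \<tau>' x) \<in> pstep R) \<and> (\<forall>x\<in>vars_at (ls ! i) P. \<tau>' x = \<tau> x)
        \<and> ts ! i = par_repl (ls ! i \<cdot> \<tau>') P (\<lambda>p. snd (\<rho> p) \<cdot> \<mu> p)"
        using Fun.IH[OF nth_mem[OF i] linear_Fun_nth[OF Fun.prems(1) i]] by blast
    qed
    then obtain P \<rho> \<mu> \<tau>' where *: "\<forall>i\<in>{..<?n}. finite (P i) \<and> P i \<subseteq> funposs (ls ! i) \<and> pairwise_par (P i)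
      \<and> (\<forall>p\<in>P i. \<rho> i p \<in> R \<and> subt_at (ls ! i) p \<cdot> \<tau> = fst (\<rho> i p) \<cdot> \<mu> i p)
      \<and> (\<forall>x. (\<tau> x, \<tau>' i x) \<in> pstep R) \<and> (\<forall>x\<in>vars_at (ls ! i) (P i). \<tau>' i x = \<tau> x)
      \<and> ts ! i = par_repl (ls ! i \<cdot> \<tau>' i) (P i) (\<lambda>p. snd (\<rho> i p) \<cdot> \<mu> i p)"
      unfolding bchoice_iff by blast
    define P' where "P' = (\<Union>i<?n. Cons i ` P i)"
    \<comment> \<open>By linearity \<open>x\<close> occurs in at most one argument, whose
      substitution supplies the value; variables outside \<open>l\<close> keep theirs.\<close>
    define \<tau>'' where "\<tau>'' x = (if \<exists>i<?n. x \<in> vars (ls ! i) then \<tau>' (THE i. i < ?n \<and> x \<in> vars (ls ! i)) x else \<tau> x)" for x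
    have \<tau>'': "\<tau>'' x = \<tau>' i x" if "i < ?n" "x \<in> vars (ls ! i)" for i x
    proof -
      have "(THE i. i < ?n \<and> x \<in> vars (ls ! i)) = i"
        using that linear_Fun_disjoint[OF Fun.prems(1)] by (intro the_equality) auto
      then show ?thesis using that unfolding \<tau>''_def by auto
    qed
    have P'_arg: "{p. i # p \<in> P'} = P i" if "i < ?n" for i using that unfolding P'_def by auto
    have P'_vars: "vars_at (Fun f ls) P' = (\<Union>i<?n. vars_at (ls ! i) (P i))"
      unfolding P'_def vars_at_def by auto
    have P_vars: "vars_at (ls ! i) (P i) \<subseteq> vars (ls ! i)" if "i < ?n" for i
      using * that vars_subt_at unfolding vars_at_def funposs_def by fastforce
    have "finite P'" unfolding P'_def using * by auto
    moreover have "P' \<subseteq> funposs (Fun f ls)" unfolding P'_def using * by (fastforce simp: funposs_def)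
    moreover have "pairwise_par P'" using * unfolding P'_def pairwise_par_def par_pos_def by fastforce
    \<comment> \<open>\<open>hd p\<close> selects the argument and \<open>tl p\<close> the position
      inside it.\<close>
    moreover have "\<forall>p\<in>P'. \<rho> (hd p) (tl p) \<in> R \<and> subt_at (Fun f ls) p \<cdot> \<tau> = fst (\<rho> (hd p) (tl p)) \<cdot> \<mu> (hd p) (tl p)"
      unfolding P'_def using * by auto
    moreover have "\<forall>x. (\<tau> x, \<tau>'' x) \<in> pstep R"
    proof
      fix x
      show "(\<tau> x, \<tau>'' x) \<in> pstep R"
        using * \<tau>''[of _ x] by (cases "\<exists>i<?n. x \<in> vars (ls ! i)") (auto simp: \<tau>''_def)
    qed
    moreover have "\<forall>x\<in>vars_at (Fun f ls) P'. \<tau>'' x = \<tau> x"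
    proof
      fix x assume "x \<in> vars_at (Fun f ls) P'"
      then obtain i where i: "i < ?n" "x \<in> vars_at (ls ! i) (P i)" using P'_vars by auto
      then show "\<tau>'' x = \<tau> x" using * \<tau>''[of i x] P_vars[of i] by auto
    qed
    moreover have "t = par_repl (Fun f ls \<cdot> \<tau>'') P' (\<lambda>p. snd (\<rho> (hd p) (tl p)) \<cdot> \<mu> (hd p) (tl p))"
    proof -
      have "ls ! i \<cdot> \<tau>'' = ls ! i \<cdot> \<tau>' i" if "i < ?n" for i
        by (rule subst_cong) (use \<tau>'' that in blast)
      moreover have "[] \<notin> P'" unfolding P'_def by auto
      ultimately show ?thesis using * P'_arg unfolding eqs(3)
        by (auto intro!: nth_equalityI simp: eqs(4))
    qed
    ultimately show ?thesis
      by (intro exI[of _ P'] exI[of _ "\<lambda>p. \<rho> (hd p) (tl p)"] exI[of _ "\<lambda>p. \<mu> (hd p) (tl p)"] exI[of _ \<tau>'']) blast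
  next
    case (pstep_root l' r' \<mu>)
    then show ?thesis
      by (intro exI[of _ "{[]}"] exI[of _ "\<lambda>_. (l', r')"] exI[of _ "\<lambda>_. \<mu>"] exI[of _ \<tau>])
        (simp add: funposs_def is_Fun_trm_def pairwise_par_def)
  qed simp
qed

text \<open>Variants demand a bijection on all variables, so \<open>X\<close> is swapped with a
  fresh disjoint copy \<open>Y\<close>, which yields an involution.\<close>

lemma fresh_renaming:
  assumes "infinite (UNIV :: 'v set)" "finite X" "finite V"
  shows "\<exists>\<pi> :: 'v \<Rightarrow> 'v. bij \<pi> \<and> \<pi> ` X \<inter> V = {}"
proof -
  have "infinite (UNIV - (X \<union> V))" using assms by simp
  then obtain Y where Y: "finite Y" "card Y = card X" "Y \<subseteq> UNIV - (X \<union> V)"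
    using infinite_arbitrarily_large by blast
  then obtain h where h: "bij_betw h X Y" using finite_same_card_bij assms(2) by metis
  define \<pi> where "\<pi> x = (if x \<in> X then h x else if x \<in> Y then inv_into X h x else x)" for x
  have "\<pi> (\<pi> x) = x" for x
    using Y(3) h bij_betwE[OF h] bij_betwE[OF bij_betw_inv_into[OF h]]
      bij_betw_inv_into_left[OF h] bij_betw_inv_into_right[OF h]
    unfolding \<pi>_def by (auto simp: subset_iff)
  then have "bij \<pi>" by (intro o_bij[of \<pi>]) auto
  moreover have "\<pi> ` X \<inter> V = {}" using bij_betwE[OF h] Y(3) unfolding \<pi>_def by auto
  ultimately show ?thesis by blast
qed

lemma fresh_renamings:
  assumes "infinite (UNIV :: 'v set)" "finite P" "finite V" "\<And>p. finite (X p)"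
  shows "\<exists>\<pi> :: 'p \<Rightarrow> 'v \<Rightarrow> 'v. (\<forall>p\<in>P. bij (\<pi> p) \<and> \<pi> p ` X p \<inter> V = {})
    \<and> (\<forall>p\<in>P. \<forall>q\<in>P. p \<noteq> q \<longrightarrow> \<pi> p ` X p \<inter> \<pi> q ` X q = {})"
  using assms(2)
proof (induction P)
  case (insert a P)
  then obtain \<pi> :: "'p \<Rightarrow> 'v \<Rightarrow> 'v" where \<pi>: "\<forall>p\<in>P. bij (\<pi> p) \<and> \<pi> p ` X p \<inter> V = {}"
    "\<forall>p\<in>P. \<forall>q\<in>P. p \<noteq> q \<longrightarrow> \<pi> p ` X p \<inter> \<pi> q ` X q = {}" by blast
  obtain \<pi>a where a: "bij \<pi>a" "\<pi>a ` X a \<inter> (V \<union> (\<Union>p\<in>P. \<pi> p ` X p)) = {}"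
    using fresh_renaming[OF assms(1), of "X a" "V \<union> (\<Union>p\<in>P. \<pi> p ` X p)"] assms(3,4) insert.hyps by auto
  have "\<pi>a x \<noteq> \<pi> p y" if "p \<in> P" "x \<in> X a" "y \<in> X p" for p x y using a(2) that by blast
  then show ?case
    by (intro exI[of _ "\<pi>(a := \<pi>a)"]) (use \<pi> a insert.hyps in \<open>auto, metis\<close>)
qed simp

definition rename_rule :: "('v \<Rightarrow> 'v) \<Rightarrow> ('f, 'v) rule \<Rightarrow> ('f, 'v) rule" where
  "rename_rule \<pi> \<rho> = (fst \<rho> \<cdot> (Var \<circ> \<pi>), snd \<rho> \<cdot> (Var \<circ> \<pi>))"

lemma vars_rename: "vars (t \<cdot> (Var \<circ> \<pi>)) = \<pi> ` vars t"
  by (auto simp: vars_subst)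

lemma vars_rule_rename: "vars_rule (rename_rule \<pi> \<rho>) = \<pi> ` vars_rule \<rho>"
  by (simp add: vars_rule_def rename_rule_def vars_rename image_Un)

lemma variant_rename: "bij \<pi> \<Longrightarrow> variant (rename_rule \<pi> \<rho>) \<rho>"
  unfolding variant_def rename_rule_def by auto

lemma variant_refl: "variant \<rho> \<rho>"
  unfolding variant_def by (auto intro!: exI[of _ id])

text \<open>The most general unifier leaves variables outside the overlaps untouched, hence a substitution
  step on those variables survives in the instance of the critical peak.\<close>

lemma root_peak_cases:
  fixes R S :: "('f, 'v) rule set"
  assumes inf: "infinite (UNIV :: 'v set)" and "trs R" "trs S" "linear_trm l"
    and lr: "(l, r) \<in> S" and t: "(l \<cdot> \<tau>, t) \<in> pstep R"
  shows "(\<exists>\<tau>'. t = l \<cdot> \<tau>' \<and> (\<forall>x. (\<tau> x, \<tau>' x) \<in> pstep R)) \<or> t = r \<cdot> \<tau> \<or>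
    (\<exists>t0 P s0 u0 \<gamma> \<gamma>'. par_crit_peak R S t0 P s0 u0 \<and> t = t0 \<cdot> \<gamma>' \<and> r \<cdot> \<tau> = u0 \<cdot> \<gamma>
       \<and> (\<forall>x. (\<gamma> x, \<gamma>' x) \<in> pstep R) \<and> (\<forall>x\<in>vars_at s0 P. \<gamma> x = \<gamma>' x))"
proof -
  obtain P \<rho> \<mu> \<tau>' where finP: "finite P" and P: "P \<subseteq> funposs l" and par: "pairwise_par P"
    and \<rho>: "\<And>p. p \<in> P \<Longrightarrow> \<rho> p \<in> R" and match: "\<And>p. p \<in> P \<Longrightarrow> subt_at l p \<cdot> \<tau> = fst (\<rho> p) \<cdot> \<mu> p"
    and \<tau>': "\<And>x. (\<tau> x, \<tau>' x) \<in> pstep R" and \<tau>'_eq: "\<And>x. x \<in> vars_at l P \<Longrightarrow> \<tau>' x = \<tau> x"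
    and t_eq: "t = par_repl (l \<cdot> \<tau>') P (\<lambda>p. snd (\<rho> p) \<cdot> \<mu> p)"
    using pstep_linear_decompose[OF assms(4) t] by blast
  have vars_lr: "vars r \<subseteq> vars l" using lr assms(3) unfolding trs_def by blast
  have vars_\<rho>: "vars (snd (\<rho> p)) \<subseteq> vars (fst (\<rho> p))" if "p \<in> P" for p
    using \<rho>[OF that] assms(2) unfolding trs_def by (auto split: prod.splits)
  have pos: "is_pos l p" if "p \<in> P" for p using that P unfolding funposs_def by blast
  show ?thesis
  proof (cases "P = {}")
    case True
    then show ?thesis using t_eq \<tau>' by auto
  next
    case False
    have "finite (vars_rule (\<rho> p))" for p by (simp add: vars_rule_def)
    \<comment> \<open>Since \<open>vars r \<subseteq> vars l\<close>, avoiding \<open>vars l\<close>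
      separates the renamed rules from the whole root rule.\<close>
    then obtain \<pi> where \<pi>: "\<And>p. p \<in> P \<Longrightarrow> bij (\<pi> p)" "\<And>p. p \<in> P \<Longrightarrow> \<pi> p ` vars_rule (\<rho> p) \<inter> vars l = {}"
      "\<And>p q. p \<in> P \<Longrightarrow> q \<in> P \<Longrightarrow> p \<noteq> q \<Longrightarrow> \<pi> p ` vars_rule (\<rho> p) \<inter> \<pi> q ` vars_rule (\<rho> q) = {}"
      using fresh_renamings[OF inf finP finite_vars[of l], of "\<lambda>p. vars_rule (\<rho> p)"] by metis
    define lr where "lr p = rename_rule (\<pi> p) (\<rho> p)" for p
    have vars_fst_lr: "vars (fst (lr p)) = \<pi> p ` vars (fst (\<rho> p))" for p
      unfolding lr_def rename_rule_def by (simp add: vars_rename)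
    have vars_snd_lr: "vars (snd (lr p)) \<subseteq> vars (fst (lr p))" if "p \<in> P" for p
      using vars_\<rho>[OF that] unfolding lr_def rename_rule_def by (auto simp: vars_rename)
    have fst_sub: "vars (fst (lr p)) \<subseteq> \<pi> p ` vars_rule (\<rho> p)" for p
      unfolding vars_fst_lr by (auto simp: vars_rule_def)
    define owner where "owner x = (THE p. p \<in> P \<and> x \<in> vars (fst (lr p)))" for x
    have owner: "owner x = p" if "p \<in> P" "x \<in> vars (fst (lr p))" for x p
      unfolding owner_def
    proof (rule the_equality)
      fix q assume q: "q \<in> P \<and> x \<in> vars (fst (lr q))"
      show "q = p"
        using that q \<pi>(3)[of q p] fst_sub[of p] fst_sub[of q] by blast
    qed (use that in blast)
    \<comment> \<open>All matchers are glued into one unifier: \<open>\<tau>\<close> on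
      \<open>l\<close>, and on each renamed rule its matcher after undoing the renaming.
      Disjointness excludes conflicts.\<close>
    define \<gamma> where "\<gamma> x = (if x \<in> vars l then \<tau> x else \<mu> (owner x) (inv (\<pi> (owner x)) x))" for x
    \<comment> \<open>\<open>\<gamma>'\<close> in addition performs the steps inside the
      substitution, which concern variables of \<open>l\<close> only.\<close>
    define \<gamma>' where "\<gamma>' x = (if x \<in> vars l then \<tau>' x else \<gamma> x)" for x
    have \<gamma>_lr: "s \<cdot> (Var \<circ> \<pi> p) \<cdot> \<gamma> = s \<cdot> \<mu> p" if p: "p \<in> P" and s: "vars s \<subseteq> vars (fst (\<rho> p))" for p s
      unfolding subst_subst
    proof (rule subst_cong)
      fix x assume x: "x \<in> vars s"
      then have "\<pi> p x \<in> vars (fst (lr p))" using s vars_fst_lr by auto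
      moreover then have "\<pi> p x \<notin> vars l" using \<pi>(2)[OF p] fst_sub by blast
      ultimately show "(Var \<circ> \<pi> p) x \<cdot> \<gamma> = \<mu> p x"
        using owner[OF p] \<pi>(1)[OF p] unfolding \<gamma>_def by (simp add: bij_is_inj)
    qed
    have \<gamma>_l: "s \<cdot> \<gamma> = s \<cdot> \<tau>" if "vars s \<subseteq> vars l" for s
      by (rule subst_cong) (use that in \<open>auto simp: \<gamma>_def\<close>)
    define E where "E = {(fst (lr p), subt_at l p) | p. p \<in> P}"
    have "unifier \<gamma> E"
      unfolding unifier_def E_def
      using \<gamma>_lr match vars_subt_at[OF pos] \<gamma>_l by (auto simp: lr_def rename_rule_def)
    moreover have "finite E" unfolding E_def using finP by simp
    then obtain Es where Es: "set Es = E" using finite_list by blast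
    ultimately obtain \<sigma> where "idem_mgu \<sigma> E" using ex_idem_mgu[of \<gamma> Es] by auto
    then have \<sigma>: "unifier \<sigma> E" "\<And>\<theta> x. unifier \<theta> E \<Longrightarrow> \<sigma> x \<cdot> \<theta> = \<theta> x" "\<And>x. x \<notin> vars_eqs E \<Longrightarrow> \<sigma> x = Var x"
       "\<And>x. x \<in> vars_eqs E \<Longrightarrow> vars (\<sigma> x) \<subseteq> vars_eqs E"
      unfolding idem_mgu_def by auto
    have \<sigma>\<gamma>: "\<sigma> x \<cdot> \<gamma> = \<gamma> x" for x using \<sigma>(2) \<open>unifier \<gamma> E\<close> by blast
    have vars_E: "vars_eqs E = (\<Union>p\<in>P. vars (fst (lr p))) \<union> vars_at l P"
      unfolding E_def vars_eqs_def vars_at_def by auto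
    \<comment> \<open>A variable of the equations lies in a renamed rule, hence outside
      \<open>l\<close>, or below \<open>P\<close>, where \<open>\<tau>'\<close> agrees with
      \<open>\<tau>\<close>.\<close>
    have \<gamma>'_E: "\<gamma>' x = \<gamma> x" if "x \<in> vars_eqs E" for x
      using that \<tau>'_eq fst_sub \<pi>(2) unfolding vars_E \<gamma>'_def \<gamma>_def by auto blast
    have \<sigma>\<gamma>'_E: "\<sigma> x \<cdot> \<gamma>' = \<gamma> x" if "x \<in> vars_eqs E" for x
      using subst_cong[of "\<sigma> x" \<gamma>' \<gamma>] \<gamma>'_E \<sigma>(4)[OF that] \<sigma>\<gamma>[of x] by auto
    \<comment> \<open>On the equations \<open>\<gamma>'\<close> equals \<open>\<gamma>\<close>,
      which absorbs \<open>\<sigma>\<close>; elsewhere \<open>\<sigma>\<close> is the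
      identity.\<close>
    have \<sigma>\<gamma>'_l: "\<sigma> x \<cdot> \<gamma>' = \<tau>' x" if "x \<in> vars l" for x
    proof (cases "x \<in> vars_eqs E")
      case True
      then show ?thesis using \<sigma>\<gamma>'_E \<gamma>'_E[OF True] that by (simp add: \<gamma>'_def)
    next
      case False
      then show ?thesis using \<sigma>(3) that by (simp add: \<gamma>'_def)
    qed
    have l\<gamma>': "l \<cdot> \<sigma> \<cdot> \<gamma>' = l \<cdot> \<tau>'"
      unfolding subst_subst by (rule subst_cong) (rule \<sigma>\<gamma>'_l)
    have r\<gamma>': "snd (lr p) \<cdot> \<sigma> \<cdot> \<gamma>' = snd (\<rho> p) \<cdot> \<mu> p" if p: "p \<in> P" for p
    proof -
      have "snd (lr p) \<cdot> \<sigma> \<cdot> \<gamma>' = snd (lr p) \<cdot> \<gamma>"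
        unfolding subst_subst
        by (rule subst_cong) (use \<sigma>\<gamma>'_E vars_E vars_snd_lr[OF p] p in blast)
      also have "\<dots> = snd (\<rho> p) \<cdot> \<mu> p"
        using \<gamma>_lr[OF p vars_\<rho>[OF p]] by (simp add: lr_def rename_rule_def)
      finally show ?thesis .
    qed
    have l_pos: "is_pos (l \<cdot> \<sigma>) p" if "p \<in> P" for p using pos[OF that] is_pos_subst by blast
    let ?t0 = "par_repl (l \<cdot> \<sigma>) P (\<lambda>p. snd (lr p) \<cdot> \<sigma>)"
    have t0: "?t0 \<cdot> \<gamma>' = t"
      unfolding t_eq using par_repl_subst[OF l_pos, of P "\<lambda>p. snd (lr p) \<cdot> \<sigma>" \<gamma>'] r\<gamma>' l\<gamma>'
      by (auto cong: par_repl_cong)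
    show ?thesis
    proof (cases "P = {[]} \<and> variant (lr []) (l, r)")
      case True
      \<comment> \<open>A rule overlapping a variant of itself at the root gives no critical peak.
        The common left-hand side determines the instance of the right-hand side, so both steps have
        the same result.\<close>
      then obtain \<beta> where \<beta>: "fst (lr []) = l \<cdot> (Var \<circ> \<beta>)" "snd (lr []) = r \<cdot> (Var \<circ> \<beta>)"
        unfolding variant_def by auto
      have nil: "[] \<in> P" using True by blast
      have "l \<cdot> (Var \<circ> \<beta>) \<cdot> \<gamma> = l \<cdot> \<tau>"
        using match[OF nil] \<gamma>_lr[OF nil, of "fst (\<rho> [])"] \<beta>(1) by (simp add: lr_def rename_rule_def)
      then have "r \<cdot> (Var \<circ> \<beta>) \<cdot> \<gamma> = r \<cdot> \<tau>"
        unfolding subst_subst using vars_lr by (meson subst_cong subst_eqD subsetD)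
      moreover have "t = snd (lr []) \<cdot> \<sigma> \<cdot> \<gamma>'" using t0 nil by simp
      moreover have "\<dots> = snd (lr []) \<cdot> \<gamma>"
        using r\<gamma>'[OF nil] \<gamma>_lr[OF nil vars_\<rho>[OF nil]] by (simp add: lr_def rename_rule_def)
      ultimately show ?thesis using \<beta>(2) by simp
    next
      case False
      have mgu: "mgu \<sigma> E" unfolding mgu_def using \<sigma>(1,2) by metis
      have "par_crit_peak R S ?t0 P (l \<cdot> \<sigma>) (r \<cdot> \<sigma>)"
        unfolding par_crit_peak_def
      proof (rule exI[of _ l], rule exI[of _ r], rule exI[of _ lr], rule exI[of _ \<sigma>], intro conjI)
        show "\<exists>\<rho>\<in>S. variant (l, r) \<rho>" using \<open>(l, r) \<in> S\<close> variant_refl by blast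
        show "\<forall>p\<in>P. \<exists>\<rho>\<in>R. variant (lr p) \<rho>" using \<rho> \<pi>(1) variant_rename unfolding lr_def by blast
        show "\<forall>p\<in>P. vars_rule (lr p) \<inter> vars_rule (l, r) = {}"
          using \<pi>(2) vars_lr unfolding lr_def vars_rule_rename by (auto simp: vars_rule_def)
        show "\<forall>p\<in>P. \<forall>q\<in>P. p \<noteq> q \<longrightarrow> vars_rule (lr p) \<inter> vars_rule (lr q) = {}"
          using \<pi>(3) unfolding lr_def vars_rule_rename by blast
        show "par_replace (l \<cdot> \<sigma>) P (\<lambda>p. snd (lr p) \<cdot> \<sigma>) ?t0" using par_replace_iff[OF par] finP by blast
      qed (use False \<open>P \<noteq> {}\<close> P par mgu[unfolded E_def] in blast)+
      moreover have "r \<cdot> \<tau> = r \<cdot> \<sigma> \<cdot> \<gamma>"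
        unfolding subst_subst by (rule subst_cong) (use \<sigma>\<gamma> vars_lr in \<open>auto simp: \<gamma>_def\<close>)
      moreover have "(\<gamma> x, \<gamma>' x) \<in> pstep R" for x using \<tau>' by (simp add: \<gamma>_def \<gamma>'_def)
      moreover have "\<gamma> x = \<gamma>' x" if x: "x \<in> vars_at (l \<cdot> \<sigma>) P" for x
      proof -
        obtain p where p: "p \<in> P" "x \<in> vars (subt_at l p \<cdot> \<sigma>)"
          using x pos by (auto simp: vars_at_def subt_at_subst)
        then obtain y where y: "y \<in> vars (subt_at l p)" "x \<in> vars (\<sigma> y)" by (auto simp: vars_subst)
        then have "y \<in> vars_eqs E" using p(1) unfolding vars_E vars_at_def by blast
        then show ?thesis using \<gamma>'_E \<sigma>(4) y(2) by (metis subsetD)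
      qed
      ultimately show ?thesis using t0 by metis
    qed
  qed
qed

section \<open>Decreasing diagrams for labeled parallel peaks\<close>

section \<open>Labeled diagrams\<close>

lemma conv_lab_subst: "(s, t) \<in> (conv_lab R \<phi> \<psi> K)\<^sup>* \<Longrightarrow> (s \<cdot> \<sigma>, t \<cdot> \<sigma>) \<in> (conv_lab R \<phi> \<psi> K)\<^sup>*"
proof (induction rule: rtrancl_induct)
  case (step y z)
  have "(y \<cdot> \<sigma>, z \<cdot> \<sigma>) \<in> conv_lab R \<phi> \<psi> K"
    using step.hyps(2) rstep_subst unfolding conv_lab_def by fast
  then show ?case using step.IH by simp
qed simp

lemma args_closed_conv_lab: "args_closed ((conv_lab R \<phi> \<psi> K)\<^sup>*)"
  by (rule args_closed_rtrancl) (use rstep_ctxt in \<open>unfold conv_lab_def, fast\<close>)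

lemma converse_conv_lab: "((conv_lab R \<phi> \<psi> K)\<^sup>*)\<inverse> = (conv_lab R \<psi> \<phi> K)\<^sup>*"
proof -
  have "(conv_lab R \<phi> \<psi> K)\<inverse> = conv_lab R \<psi> \<phi> K" unfolding conv_lab_def by auto
  then show ?thesis by (simp add: rtrancl_converse[symmetric])
qed

text \<open>The joining sequence of \<open>decreasing\<close> as a single relation with
  \<open>pstep\<close> for the parallel steps. In this form it is closed under arguments, and its
  converse exchanges the labelings.\<close>

definition diagram :: "('f, 'v) rule set \<Rightarrow> (('f, 'v) rule \<Rightarrow> nat) \<Rightarrow> (('f, 'v) rule \<Rightarrow> nat) \<Rightarrow> nat \<Rightarrow> nat
    \<Rightarrow> (('f, 'v) trm \<times> ('f, 'v) trm) set" where
  "diagram R \<phi> \<psi> k m = (conv_lab R \<phi> \<psi> {j. j < k})\<^sup>* O pstep (lab R \<psi> m)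
     O (conv_lab R \<phi> \<psi> ({j. j < k} \<union> {j. j < m}))\<^sup>* O (pstep (lab R \<phi> k))\<inverse> O (conv_lab R \<phi> \<psi> {j. j < m})\<^sup>*"

lemma diagramI:
  assumes "(t, a) \<in> (conv_lab R \<phi> \<psi> {j. j < k})\<^sup>*" "(a, b) \<in> pstep (lab R \<psi> m)"
    "(b, v) \<in> (conv_lab R \<phi> \<psi> ({j. j < k} \<union> {j. j < m}))\<^sup>*" "(w, v) \<in> pstep (lab R \<phi> k)"
    "(w, u) \<in> (conv_lab R \<phi> \<psi> {j. j < m})\<^sup>*"
  shows "(t, u) \<in> diagram R \<phi> \<psi> k m"
  unfolding diagram_def using assms by blast

lemma converse_diagram: "(diagram R \<phi> \<psi> k m)\<inverse> = diagram R \<psi> \<phi> m k"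
  unfolding diagram_def by (simp add: converse_relcomp converse_conv_lab O_assoc Un_commute)

lemma args_closed_diagram: "args_closed (diagram R \<phi> \<psi> k m)"
  unfolding diagram_def
  by (intro args_closed_relcomp args_closed_converse args_closed_conv_lab args_closed_pstep)

text \<open>Without overlap the two steps form a commuting square, a self-overlap at the root is
  trivial, and every other overlap is an instance of a critical peak, whose diagram is
  instantiated.\<close>

lemma root_peak_diagram:
  fixes R :: "('f, 'v) rule set"
  assumes "infinite (UNIV :: 'v set)" "trs R" "left_linear R"
    and dec: "\<And>t P s u. par_crit_peak (lab R \<phi> k) (lab R \<psi> m) t P s u \<Longrightarrow> decreasing R \<phi> \<psi> k m t P s u"
    and lr: "(l, r) \<in> lab R \<psi> m" and t: "(l \<cdot> \<tau>, t) \<in> pstep (lab R \<phi> k)"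
  shows "(t, r \<cdot> \<tau>) \<in> diagram R \<phi> \<psi> k m"
proof -
  have trs: "trs (lab R \<phi> k)" "trs (lab R \<psi> m)" and lin: "linear_trm l"
    using assms(2,3) lr unfolding trs_def left_linear_def lab_def by blast+
  consider
    (var) \<tau>' where "t = l \<cdot> \<tau>'" "\<And>x. (\<tau> x, \<tau>' x) \<in> pstep (lab R \<phi> k)"
  | (trivial) "t = r \<cdot> \<tau>"
  | (crit) t0 P s0 u0 \<gamma> \<gamma>' where "par_crit_peak (lab R \<phi> k) (lab R \<psi> m) t0 P s0 u0"
      "t = t0 \<cdot> \<gamma>'" "r \<cdot> \<tau> = u0 \<cdot> \<gamma>"
      "\<And>x. (\<gamma> x, \<gamma>' x) \<in> pstep (lab R \<phi> k)" "\<And>x. x \<in> vars_at s0 P \<Longrightarrow> \<gamma> x = \<gamma>' x"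
    using root_peak_cases[OF assms(1) trs lin lr t] by blast
  then show ?thesis
  proof cases
    case var
    have "(t, r \<cdot> \<tau>') \<in> pstep (lab R \<psi> m)" using pstep_root[OF lr] var(1) by blast
    moreover have "(r \<cdot> \<tau>, r \<cdot> \<tau>') \<in> pstep (lab R \<phi> k)" by (rule pstep_subst) (rule var(2))
    ultimately show ?thesis by (rule diagramI[OF rtrancl_refl _ rtrancl_refl _ rtrancl_refl])
  next
    case trivial
    then show ?thesis by (simp add: diagramI[OF rtrancl_refl pstep_refl rtrancl_refl pstep_refl rtrancl_refl])
  next
    case crit
    then have "decreasing R \<phi> \<psi> k m t0 P s0 u0" using dec by blast
    then obtain v P' w a b where d: "(t0, a) \<in> (conv_lab R \<phi> \<psi> {j. j < k})\<^sup>*" "(a, b) \<in> par_step (lab R \<psi> m)"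
      "(b, v) \<in> (conv_lab R \<phi> \<psi> ({j. j < k} \<union> {j. j < m}))\<^sup>*" "par_step_at (lab R \<phi> k) P' w v"
      "(w, u0) \<in> (conv_lab R \<phi> \<psi> {j. j < m})\<^sup>*" "vars_at v P' \<subseteq> vars_at s0 P"
      unfolding decreasing_def by blast
    have "(a, b) \<in> pstep (lab R \<psi> m)" using d(2) par_step_subset_pstep by blast
    then have ab: "(a \<cdot> \<gamma>', b \<cdot> \<gamma>') \<in> pstep (lab R \<psi> m)" by (rule pstep_closed_subst)
    \<comment> \<open>The part of the diagram on the side of \<open>t\<close> is instantiated by
      \<open>\<gamma>'\<close>, the part on the side of \<open>r \<cdot> \<tau>\<close> by
      \<open>\<gamma>\<close>. This step passes from one to the other, as the variable condition
      permits.\<close>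
    have "(w \<cdot> \<gamma>, v \<cdot> \<gamma>') \<in> pstep (lab R \<phi> k)"
    proof (rule par_step_at_subst[OF d(4) crit(4)])
      show "\<gamma> x = \<gamma>' x" if "x \<in> vars_at v P'" for x using crit(5) d(6) that by blast
    qed
    then show ?thesis unfolding crit(2,3)
      by (rule diagramI[OF conv_lab_subst[OF d(1)] ab conv_lab_subst[OF d(3)] _ conv_lab_subst[OF d(5)]])
  qed
qed

text \<open>If one of the steps is at the root, the root case applies, after a converse when it is
  the \<open>\<phi>\<close> step. Otherwise both steps act on the arguments, and their diagrams are
  combined by \<open>args_closed\<close>.\<close>

lemma par_peak_diagram:
  fixes R :: "('f, 'v) rule set"
  assumes "infinite (UNIV :: 'v set)" "trs R" "left_linear R"
    and "\<And>t P s u. par_crit_peak (lab R \<phi> k) (lab R \<psi> m) t P s u \<Longrightarrow> decreasing R \<phi> \<psi> k m t P s u"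
    and "\<And>t P s u. par_crit_peak (lab R \<psi> m) (lab R \<phi> k) t P s u \<Longrightarrow> decreasing R \<psi> \<phi> m k t P s u"
    and "(s, t) \<in> pstep (lab R \<phi> k)" "(s, u) \<in> pstep (lab R \<psi> m)"
  shows "(t, u) \<in> diagram R \<phi> \<psi> k m"
  using assms(6,7)
proof (induction s arbitrary: t u)
  case (Var x)
  from Var.prems(2) show ?case
  proof (cases rule: pstep.cases)
    case pstep_Var
    from Var.prems(1) show ?thesis
    proof (cases rule: pstep.cases)
      case pstep_Var
      then show ?thesis using \<open>u = Var _\<close>
        by (auto intro: diagramI[OF rtrancl_refl pstep_refl rtrancl_refl pstep_refl rtrancl_refl])
    next
      case (pstep_root l r \<mu>)
      then have "(u, t) \<in> diagram R \<psi> \<phi> m k" using root_peak_diagram[OF assms(1-3) assms(5)] Var.prems by simp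
      then show ?thesis using converse_diagram by blast
    qed
  next
    case (pstep_root l r \<mu>)
    then show ?thesis using root_peak_diagram[OF assms(1-4)] Var.prems by simp
  qed
next
  case (Fun f ss)
  from Fun.prems(2) show ?case
  proof (cases rule: pstep.cases)
    case u: (pstep_Fun us)
    from Fun.prems(1) show ?thesis
    proof (cases rule: pstep.cases)
      case t: (pstep_Fun ts)
      have "(ts ! i, us ! i) \<in> diagram R \<phi> \<psi> k m" if "i < length us" for i
        using Fun.IH[of "ss ! i"] t u that by auto
      then show ?thesis using args_closed_diagram[of R \<phi> \<psi> k m] t u unfolding args_closed_def by auto
    next
      case (pstep_root l r \<mu>)
      then have "(u, t) \<in> diagram R \<psi> \<phi> m k" using root_peak_diagram[OF assms(1-3) assms(5)] Fun.prems by simp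
      then show ?thesis using converse_diagram by blast
    qed
  next
    case (pstep_root l r \<mu>)
    then show ?thesis using root_peak_diagram[OF assms(1-4)] Fun.prems by simp
  qed
qed

lemma conv_lab_subset_conv_below:
  "(conv_lab R \<phi> \<psi> {j. j < k})\<^sup>* \<subseteq> conv_below (\<lambda>k. pstep (lab R \<phi> k)) (\<lambda>m. pstep (lab R \<psi> m)) k"
  unfolding conv_below_def conv_lab_def
  by (rule rtrancl_mono) (use rstep_subset_pstep in fast)

lemma lab_mono: "i \<le> j \<Longrightarrow> lab R \<phi> i \<subseteq> lab R \<phi> j"
  by (auto simp: lab_def)

lemma rsteps_lab:
  assumes "(s, t) \<in> (rstep R)\<^sup>*"
  shows "\<exists>k. (s, t) \<in> (pstep (lab R \<phi> k))\<^sup>*"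
  using assms
proof (induction rule: rtrancl_induct)
  case (step y z)
  then obtain k where k: "(s, y) \<in> (pstep (lab R \<phi> k))\<^sup>*" by blast
  \<comment> \<open>Singling out the contracted rule gives the step a definite label.\<close>
  obtain l r where "(l, r) \<in> R" "(y, z) \<in> rstep {(l, r)}" using step.hyps(2) unfolding rstep_def by auto
  then have "(y, z) \<in> pstep (lab R \<phi> (\<phi> (l, r)))"
    using rstep_subset_pstep pstep_mono[of "{(l, r)}" "lab R \<phi> (\<phi> (l, r))"] by (auto simp: lab_def)
  then have "(y, z) \<in> pstep (lab R \<phi> (max k (\<phi> (l, r))))"
    using pstep_mono[OF lab_mono[of "\<phi> (l, r)" "max k (\<phi> (l, r))" R \<phi>]] by auto
  moreover have "(s, y) \<in> (pstep (lab R \<phi> (max k (\<phi> (l, r)))))\<^sup>*"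
    using k rtrancl_mono[OF pstep_mono[OF lab_mono[of k "max k (\<phi> (l, r))" R \<phi>]]] by auto
  ultimately show ?case by (meson rtrancl.rtrancl_into_rtrancl)
qed blast

theorem theorem9:
  fixes R :: "('f, 'v) rule set" and \<phi> \<psi> :: "('f, 'v) rule \<Rightarrow> nat"
  assumes "infinite (UNIV :: 'v set)"
    and "trs R"
    and "left_linear R"
    and "commute (lab R \<phi> 0) (lab R \<psi> 0)"
    and "\<forall>k m. (k, m) \<noteq> (0, 0) \<longrightarrow>
           (\<forall>t P s u. par_crit_peak (lab R \<phi> k) (lab R \<psi> m) t P s u
                        \<longrightarrow> decreasing R \<phi> \<psi> k m t P s u)
         \<and> (\<forall>t P s u. par_crit_peak (lab R \<psi> m) (lab R \<phi> k) t P s u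
                        \<longrightarrow> decreasing R \<psi> \<phi> m k t P s u)"
  shows "confluent R"
proof -
  let ?A = "\<lambda>k. pstep (lab R \<phi> k)" and ?B = "\<lambda>m. pstep (lab R \<psi> m)"
  interpret decreasing_family ?A ?B
  proof
    fix s t u assume "(s, t) \<in> (?A 0)\<^sup>*" "(s, u) \<in> (?B 0)\<^sup>*"
    then have "(t, u) \<in> ((rstep (lab R \<phi> 0))\<inverse>)\<^sup>* O (rstep (lab R \<psi> 0))\<^sup>*"
      unfolding rtrancl_pstep rtrancl_converse by blast
    then show "\<exists>v. (t, v) \<in> (?B 0)\<^sup>* \<and> (u, v) \<in> (?A 0)\<^sup>*"
      using assms(4) unfolding commute_def rtrancl_pstep rtrancl_converse by blast
  next
    fix k m :: nat
    assume km: "(k, m) \<noteq> (0, 0)"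
    have union: "{j. j < k} \<union> {j. j < m} = {j. j < max k m}" by auto
    show "(?A k)\<inverse> O ?B m \<subseteq> conv_below ?A ?B k O ?B m O conv_below ?A ?B (max k m) O (?A k)\<inverse> O conv_below ?A ?B m"
    proof
      fix x assume "x \<in> (?A k)\<inverse> O ?B m"
      then have "x \<in> diagram R \<phi> \<psi> k m"
        using par_peak_diagram[OF assms(1-3), of \<phi> k \<psi> m] assms(5)[rule_format, OF km] by blast
      then show "x \<in> conv_below ?A ?B k O ?B m O conv_below ?A ?B (max k m) O (?A k)\<inverse> O conv_below ?A ?B m"
        unfolding diagram_def union
        by (rule subsetD[rotated]) (intro relcomp_mono conv_lab_subset_conv_below subset_refl)
    qed
  qed (intro pstep_mono lab_mono; assumption)+
  show ?thesis unfolding confluent_def commute_def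
  proof (rule subrelI)
    fix t u assume "(t, u) \<in> ((rstep R)\<inverse>)\<^sup>* O (rstep R)\<^sup>*"
    then obtain s where "(s, t) \<in> (rstep R)\<^sup>*" "(s, u) \<in> (rstep R)\<^sup>*"
      unfolding rtrancl_converse by blast
    \<comment> \<open>Every rule carries both labels: reading one sequence with
      \<open>\<phi>\<close> and the other with \<open>\<psi>\<close> turns a peak of
      \<open>R\<close> into a peak between the two families.\<close>
    then obtain k m where "(s, t) \<in> (?A k)\<^sup>*" "(s, u) \<in> (?B m)\<^sup>*" using rsteps_lab by metis
    \<comment> \<open>The successor compensates for the strict bound in
      \<open>conv_below\<close>.\<close>
    then have "(t, s) \<in> conv_below ?A ?B (Suc (max k m))" "(s, u) \<in> conv_below ?A ?B (Suc (max k m))"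
      using backward_conv_below[of k "Suc (max k m)" s t ?A] forward_conv_below[of m "Suc (max k m)" s u ?B] by auto
    then have "(t, u) \<in> conv_below ?A ?B (Suc (max k m))" by (rule conv_below_trans)
    then obtain v where v: "(t, v) \<in> (?B (max k m))\<^sup>*" "(u, v) \<in> (?A (max k m))\<^sup>*"
      using cr_at unfolding cr_at_def by blast
    have sub: "rstep (lab R \<chi> n) \<subseteq> rstep R" for \<chi> n unfolding rstep_def lab_def by blast
    have "(t, v) \<in> (rstep R)\<^sup>*" "(u, v) \<in> (rstep R)\<^sup>*"
      using v rtrancl_mono[OF sub] unfolding rtrancl_pstep by blast+
    then show "(t, u) \<in> (rstep R)\<^sup>* O ((rstep R)\<inverse>)\<^sup>*" unfolding rtrancl_converse by blast
  qed
qed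

end
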